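(* Let $(\mathfrak h,\langle\,,\,\rangle_{\mathfrak h})$ and $(\mathfrak d,\langle\,,\,\rangle_{\mathfrak d})$ be Lie algebras with ad-invariant metrics, let $\pi:\mathfrak h\to\mathrm{Dera}(\mathfrak d,\langle\,,\,\rangle_{\mathfrak d})$ be a Lie algebra homomorphism, and let $\mathcal G(D)$ be the simply connected Lie group with Lie algebra $\mathcal G(\mathfrak d)=\mathfrak d\oplus\mathfrak h^*$ endowed with the pseudo-Riemannian metric obtained by left-translations of $\langle\,,\,\rangle$ (all as in the context). Then the left-invariant $(1,2)$ tensor $T$ on $\mathcal G(D)$ given on $\mathcal G(\mathfrak d)$ by $$T_xy=\tfrac12\lambda^{-1}\big([\lambda x,\lambda y]_{\mathfrak m}\big),\qquad x,y\in\mathcal G(\mathfrak d),$$ explicitly $$T_{x_1+h_1^*}(x_2+h_2^* )=\tfrac12\big([x_1,x_2]+\pi(h_1)x_2-\pi(h_2)x_1\big)+[h_1,h_2]_{\mathfrak h}^*\qquad (x_i\in\mathfrak d,\ h_i\in\mathfrak h),$$ defines a naturally reductive homogeneous structure on $\mathcal G(D)$.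
   Context: All Lie algebras are real and finite-dimensional. An ad-invariant metric on a Lie algebra is a nondegenerate symmetric bilinear form $B$ (of any signature) with $B([x,y],z)=-B(y,[x,z])$. $\mathrm{Dera}(\mathfrak d,\langle\,,\,\rangle_{\mathfrak d})$ is the Lie algebra of derivations of $\mathfrak d$ that are skew-symmetric for $\langle\,,\,\rangle_{\mathfrak d}$. For $h\in\mathfrak h$ let $h^*:=\langle h,\cdot\rangle_{\mathfrak h}\in\mathfrak h^*$; $h\mapsto h^*$ is a linear isomorphism $\mathfrak h\to\mathfrak h^*$. Define $\beta(x_1,x_2)(h)=\langle\pi(h)x_1,x_2\rangle_{\mathfrak d}$, so $\beta:\mathfrak d\times\mathfrak d\to\mathfrak h^*$. The Lie algebra $\mathcal G(\mathfrak d)=\mathfrak d\oplus\mathfrak h^*$ has bracket $[x_1+h_1^*,x_2+h_2^*]=[x_1,x_2]_{\mathfrak d}+\beta(x_1,x_2)$ and metric $\langle x_1+h_1^*,x_2+h_2^*\rangle=\langle h_1,h_2\rangle_{\mathfrak h}+\langle x_1,x_2\rangle_{\mathfrak d}$. In the formula for $T$, $[x_1,x_2]$ is the bracket in $\mathcal G(\mathfrak d)$. Let $\mathfrak g=\mathfrak h\oplus\mathfrak d\oplus\mathfrak h^*$ with bracket $$[(h_1,x_1,\alpha_1),(h_2,x_2,\alpha_2)]=\big([h_1,h_2]_{\mathfrak h},\ [x_1,x_2]_{\mathfrak d}+\pi(h_1)x_2-\pi(h_2)x_1,\ \beta(x_1,x_2)+\mathrm{ad}^*_{\mathfrak h}(h_1)\alpha_2-\mathrm{ad}^*_{\mathfrak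 h}(h_2)\alpha_1\big),$$ where $\mathrm{ad}^*_{\mathfrak h}(h)\alpha=-\alpha\circ\mathrm{ad}_{\mathfrak h}(h)$. Let $\mathfrak m=\{(h,x,h^* ):h\in\mathfrak h,x\in\mathfrak d\}$, so that $\mathfrak g=\mathfrak h\oplus\mathfrak m$ (with $\mathfrak h$ identified with $\{(h,0,0)\}$), let $[\,,\,]_{\mathfrak m}$ denote the $\mathfrak m$-component of the bracket along this decomposition, and let $\lambda:\mathcal G(\mathfrak d)\to\mathfrak m$ be the linear isomorphism $\lambda(x+h^* )=(h,x,h^* )$. On a connected, simply connected pseudo-Riemannian manifold $(M,g)$ with Levi-Civita connection $\nabla$ and curvature $R(X,Y)=[\nabla_X,\nabla_Y]-\nabla_{[X,Y]}$, a naturally reductive homogeneous structure (homogeneous structure of type $\mathcal T_3$) is a $(1,2)$ tensor field $T$ such that for all vector fields $X,Y,Z$: (i) $g(T_XY,Z)+g(Y,T_XZ)=0$; (ii) $(\nabla_XR)(Y,Z)=[T_X,R(Y,Z)]-R(T_XY,Z)-R(Y,T_XZ)$; (iii) $(\nabla_XT)_Y=[T_X,T_Y]-T_{T_XY}$; (iv) $T_XX=0$. *)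

theory Defs
  imports "HOL-Analysis.Analysis" "HOL-Library.Function_Algebras"
begin

section \<open>Linear algebra\<close>

definition fin_dim :: "'a::real_vector itself \<Rightarrow> bool" where
  "fin_dim _ \<longleftrightarrow> (\<exists>B::'a set. finite B \<and> span B = UNIV)"

typedef (overloaded) ('a::real_vector) lin_dual = "{\<alpha> :: 'a \<Rightarrow> real. linear \<alpha>}"
  morphisms dual_app Abs_dual
  by (rule exI[of _ "\<lambda>_. 0"]) (simp add: module_hom_zero)

lemma linear_dual_app: "linear (dual_app \<alpha>)"
  using dual_app[of \<alpha>] by simp

lemma dual_app_Abs_dual: "linear \<alpha> \<Longrightarrow> dual_app (Abs_dual \<alpha>) = \<alpha>"
  by (simp add: Abs_dual_inverse)

instantiation lin_dual :: (real_vector) real_vector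
begin

definition zero_lin_dual :: "'a lin_dual" where
  "zero_lin_dual = Abs_dual (\<lambda>_. 0)"

definition plus_lin_dual :: "'a lin_dual \<Rightarrow> 'a lin_dual \<Rightarrow> 'a lin_dual" where
  "plus_lin_dual \<alpha> \<gamma> = Abs_dual (\<lambda>h. dual_app \<alpha> h + dual_app \<gamma> h)"

definition minus_lin_dual :: "'a lin_dual \<Rightarrow> 'a lin_dual \<Rightarrow> 'a lin_dual" where
  "minus_lin_dual \<alpha> \<gamma> = Abs_dual (\<lambda>h. dual_app \<alpha> h - dual_app \<gamma> h)"

definition uminus_lin_dual :: "'a lin_dual \<Rightarrow> 'a lin_dual" where
  "uminus_lin_dual \<alpha> = Abs_dual (\<lambda>h. - dual_app \<alpha> h)"

definition scaleR_lin_dual :: "real \<Rightarrow> 'a lin_dual \<Rightarrow> 'a lin_dual" where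
  "scaleR_lin_dual c \<alpha> = Abs_dual (\<lambda>h. c * dual_app \<alpha> h)"

lemma dual_app_simps:
  "dual_app (0 :: 'a lin_dual) h = 0"
  "dual_app (\<alpha> + \<gamma>) h = dual_app \<alpha> h + dual_app \<gamma> h"
  "dual_app (\<alpha> - \<gamma>) h = dual_app \<alpha> h - dual_app \<gamma> h"
  "dual_app (- \<alpha>) h = - dual_app \<alpha> h"
  "dual_app (c *\<^sub>R \<alpha>) h = c * dual_app \<alpha> h"
proof -
  have "linear (\<lambda>_::'a. 0::real)" by (simp add: module_hom_zero)
  then show "dual_app (0 :: 'a lin_dual) h = 0"
    by (simp add: zero_lin_dual_def dual_app_Abs_dual)
  show "dual_app (\<alpha> + \<gamma>) h = dual_app \<alpha> h + dual_app \<gamma> h"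
    unfolding plus_lin_dual_def
    by (subst dual_app_Abs_dual) (auto intro: linear_compose_add linear_dual_app)
  show "dual_app (\<alpha> - \<gamma>) h = dual_app \<alpha> h - dual_app \<gamma> h"
    unfolding minus_lin_dual_def
    by (subst dual_app_Abs_dual) (auto intro: linear_compose_sub linear_dual_app)
  show "dual_app (- \<alpha>) h = - dual_app \<alpha> h"
    unfolding uminus_lin_dual_def
    by (subst dual_app_Abs_dual) (auto intro: linear_compose_neg linear_dual_app)
  show "dual_app (c *\<^sub>R \<alpha>) h = c * dual_app \<alpha> h"
    unfolding scaleR_lin_dual_def
    using linear_compose_scale_right[OF linear_dual_app[of \<alpha>], of c]
    by (subst dual_app_Abs_dual) auto
qed

lemma lin_dual_eqI: "(\<And>h. dual_app \<alpha> h = dual_app \<gamma> h) \<Longrightarrow> \<alpha> = \<gamma>"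
  by (metis dual_app_inject ext)

instance
  by standard (auto intro!: lin_dual_eqI simp: dual_app_simps algebra_simps)

end


section \<open>Lie algebras with ad-invariant metrics\<close>

definition lie_algebra :: "('a::real_vector \<Rightarrow> 'a \<Rightarrow> 'a) \<Rightarrow> bool" where
  "lie_algebra br \<longleftrightarrow>
     fin_dim TYPE('a) \<and> bilinear br \<and> (\<forall>x. br x x = 0) \<and>
     (\<forall>x y z. br x (br y z) + br y (br z x) + br z (br x y) = 0)"

definition ad_invariant_metric ::
    "('a::real_vector \<Rightarrow> 'a \<Rightarrow> 'a) \<Rightarrow> ('a \<Rightarrow> 'a \<Rightarrow> real) \<Rightarrow> bool" where
  "ad_invariant_metric br B \<longleftrightarrow>
     bilinear B \<and> (\<forall>x y. B x y = B y x) \<and> (\<forall>x. (\<forall>y. B x y = 0) \<longrightarrow> x = 0) \<and>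
     (\<forall>x y z. B (br x y) z = - B y (br x z))"

definition Dera ::
    "('a::real_vector \<Rightarrow> 'a \<Rightarrow> 'a) \<Rightarrow> ('a \<Rightarrow> 'a \<Rightarrow> real) \<Rightarrow> ('a \<Rightarrow> 'a) set" where
  "Dera br B =
     {D. linear D \<and> (\<forall>x y. D (br x y) = br (D x) y + br x (D y)) \<and>
         (\<forall>x y. B (D x) y = - B x (D y))}"

definition lie_hom_Dera ::
    "('h::real_vector \<Rightarrow> 'h \<Rightarrow> 'h) \<Rightarrow> ('d::real_vector \<Rightarrow> 'd \<Rightarrow> 'd) \<Rightarrow> ('d \<Rightarrow> 'd \<Rightarrow> real)
      \<Rightarrow> ('h \<Rightarrow> 'd \<Rightarrow> 'd) \<Rightarrow> bool" where
  "lie_hom_Dera hbr dbr dB \<pi> \<longleftrightarrow>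
     (\<forall>h. \<pi> h \<in> Dera dbr dB) \<and> (\<forall>x. linear (\<lambda>h. \<pi> h x)) \<and>
     (\<forall>h k x. \<pi> (hbr h k) x = \<pi> h (\<pi> k x) - \<pi> k (\<pi> h x))"


section \<open>The Lie algebras \<open>\<G>(\<dd>) = \<dd> \<oplus> \<hh>\<^sup>*\<close> and \<open>\<gg> = \<hh> \<oplus> \<dd> \<oplus> \<hh>\<^sup>*\<close>\<close>

definition flat :: "('h::real_vector \<Rightarrow> 'h \<Rightarrow> real) \<Rightarrow> 'h \<Rightarrow> 'h lin_dual" where
  "flat hB h = Abs_dual (hB h)"

definition sharp :: "('h::real_vector \<Rightarrow> 'h \<Rightarrow> real) \<Rightarrow> 'h lin_dual \<Rightarrow> 'h" where
  "sharp hB = inv (flat hB)"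

definition beta ::
    "('d::real_vector \<Rightarrow> 'd \<Rightarrow> real) \<Rightarrow> ('h::real_vector \<Rightarrow> 'd \<Rightarrow> 'd) \<Rightarrow> 'd \<Rightarrow> 'd \<Rightarrow> 'h lin_dual" where
  "beta dB \<pi> x1 x2 = Abs_dual (\<lambda>h. dB (\<pi> h x1) x2)"

definition coad :: "('h::real_vector \<Rightarrow> 'h \<Rightarrow> 'h) \<Rightarrow> 'h \<Rightarrow> 'h lin_dual \<Rightarrow> 'h lin_dual" where
  "coad hbr h \<alpha> = Abs_dual (\<lambda>k. - dual_app \<alpha> (hbr h k))"

fun Gd_bracket ::
    "('d::real_vector \<Rightarrow> 'd \<Rightarrow> 'd) \<Rightarrow> ('d \<Rightarrow> 'd \<Rightarrow> real) \<Rightarrow> ('h::real_vector \<Rightarrow> 'd \<Rightarrow> 'd)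
      \<Rightarrow> 'd \<times> 'h lin_dual \<Rightarrow> 'd \<times> 'h lin_dual \<Rightarrow> 'd \<times> 'h lin_dual" where
  "Gd_bracket dbr dB \<pi> (x1, \<alpha>1) (x2, \<alpha>2) = (dbr x1 x2, beta dB \<pi> x1 x2)"

fun Gd_metric ::
    "('h::real_vector \<Rightarrow> 'h \<Rightarrow> real) \<Rightarrow> ('d::real_vector \<Rightarrow> 'd \<Rightarrow> real)
      \<Rightarrow> 'd \<times> 'h lin_dual \<Rightarrow> 'd \<times> 'h lin_dual \<Rightarrow> real" where
  "Gd_metric hB dB (x1, \<alpha>1) (x2, \<alpha>2) = hB (sharp hB \<alpha>1) (sharp hB \<alpha>2) + dB x1 x2"

fun g_bracket ::
    "('h::real_vector \<Rightarrow> 'h \<Rightarrow> 'h) \<Rightarrow> ('d::real_vector \<Rightarrow> 'd \<Rightarrow> 'd) \<Rightarrow> ('d \<Rightarrow> 'd \<Rightarrow> real)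
      \<Rightarrow> ('h \<Rightarrow> 'd \<Rightarrow> 'd)
      \<Rightarrow> 'h \<times> 'd \<times> 'h lin_dual \<Rightarrow> 'h \<times> 'd \<times> 'h lin_dual \<Rightarrow> 'h \<times> 'd \<times> 'h lin_dual" where
  "g_bracket hbr dbr dB \<pi> (h1, x1, \<alpha>1) (h2, x2, \<alpha>2) =
     (hbr h1 h2,
      dbr x1 x2 + \<pi> h1 x2 - \<pi> h2 x1,
      beta dB \<pi> x1 x2 + coad hbr h1 \<alpha>2 - coad hbr h2 \<alpha>1)"

definition h_sub :: "('h::real_vector \<times> 'd::real_vector \<times> 'h lin_dual) set" where
  "h_sub = {(h, 0, 0) | h. True}"

definition m_sub ::
    "('h::real_vector \<Rightarrow> 'h \<Rightarrow> real) \<Rightarrow> ('h \<times> 'd::real_vector \<times> 'h lin_dual) set" where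
  "m_sub hB = {(h, x, flat hB h) | h x. True}"

definition m_part ::
    "('h::real_vector \<Rightarrow> 'h \<Rightarrow> real)
      \<Rightarrow> 'h \<times> 'd::real_vector \<times> 'h lin_dual \<Rightarrow> 'h \<times> 'd \<times> 'h lin_dual" where
  "m_part hB v = (THE w. w \<in> m_sub hB \<and> v - w \<in> h_sub)"

definition lam ::
    "('h::real_vector \<Rightarrow> 'h \<Rightarrow> real) \<Rightarrow> 'd::real_vector \<times> 'h lin_dual \<Rightarrow> 'h \<times> 'd \<times> 'h lin_dual" where
  "lam hB = (\<lambda>(x, \<alpha>). (sharp hB \<alpha>, x, \<alpha>))"

definition T_alg ::
    "('h::real_vector \<Rightarrow> 'h \<Rightarrow> 'h) \<Rightarrow> ('h \<Rightarrow> 'h \<Rightarrow> real)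
      \<Rightarrow> ('d::real_vector \<Rightarrow> 'd \<Rightarrow> 'd) \<Rightarrow> ('d \<Rightarrow> 'd \<Rightarrow> real) \<Rightarrow> ('h \<Rightarrow> 'd \<Rightarrow> 'd)
      \<Rightarrow> 'd \<times> 'h lin_dual \<Rightarrow> 'd \<times> 'h lin_dual \<Rightarrow> 'd \<times> 'h lin_dual" where
  "T_alg hbr hB dbr dB \<pi> x y =
     (1/2) *\<^sub>R inv (lam hB) (m_part hB (g_bracket hbr dbr dB \<pi> (lam hB x) (lam hB y)))"


section \<open>Smooth manifolds\<close>

primrec C_k_on ::
    "nat \<Rightarrow> 'a::real_normed_vector set \<Rightarrow> ('a \<Rightarrow> 'b::real_normed_vector) \<Rightarrow> bool" where
  "C_k_on 0 S f \<longleftrightarrow> continuous_on S f"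
| "C_k_on (Suc k) S f \<longleftrightarrow>
     (\<forall>x\<in>S. f differentiable (at x)) \<and>
     (\<forall>v. C_k_on k S (\<lambda>x. frechet_derivative f (at x) v))"

text \<open>Only used for open sets in finite-dimensional spaces, where control of all directional
  derivatives is the usual notion of smoothness.\<close>

definition smooth_on ::
    "'a::real_normed_vector set \<Rightarrow> ('a \<Rightarrow> 'b::real_normed_vector) \<Rightarrow> bool" where
  "smooth_on S f \<longleftrightarrow> (\<forall>k. C_k_on k S f)"

text \<open>A chart is a pair of its domain and its coordinate map, only meaningful on the domain. The
  model space is a finite-dimensional real inner product space rather than a type of class
  \<open>euclidean_space\<close>, since the latter excludes dimension zero.\<close>

type_synonym ('m, 'e) chart = "'m set \<times> ('m \<Rightarrow> 'e)"

definition is_chart :: "('m::topological_space, 'e::real_inner) chart \<Rightarrow> bool" where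
  "is_chart c \<longleftrightarrow>
     (case c of (U, \<phi>) \<Rightarrow>
        open U \<and> open (\<phi> ` U) \<and> homeomorphism U (\<phi> ` U) \<phi> (inv_into U \<phi>))"

definition smooth_manifold ::
    "('m::{t2_space, second_countable_topology}, 'e::real_inner) chart set \<Rightarrow> bool" where
  "smooth_manifold A \<longleftrightarrow>
     fin_dim TYPE('e) \<and> (\<Union>(U, \<phi>)\<in>A. U) = UNIV \<and> (\<forall>c\<in>A. is_chart c) \<and>
     (\<forall>(U, \<phi>)\<in>A. \<forall>(V, \<psi>)\<in>A. smooth_on (\<phi> ` (U \<inter> V)) (\<psi> \<circ> inv_into U \<phi>))"

definition smooth_map ::
    "('m::topological_space, 'e::real_inner) chart set
      \<Rightarrow> ('n::topological_space, 'f::real_inner) chart set \<Rightarrow> ('m \<Rightarrow> 'n) \<Rightarrow> bool" where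
  "smooth_map A B F \<longleftrightarrow>
     continuous_on UNIV F \<and>
     (\<forall>(U, \<phi>)\<in>A. \<forall>(V, \<psi>)\<in>B.
        smooth_on (\<phi> ` (U \<inter> F -` V)) (\<psi> \<circ> F \<circ> inv_into U \<phi>))"

definition prod_atlas ::
    "('m, 'e) chart set \<Rightarrow> ('n, 'f) chart set \<Rightarrow> ('m \<times> 'n, 'e \<times> 'f) chart set" where
  "prod_atlas A B =
     {(U \<times> V, map_prod \<phi> \<psi>) | U \<phi> V \<psi>. (U, \<phi>) \<in> A \<and> (V, \<psi>) \<in> B}"

definition smooth_funs :: "('m, 'e::real_inner) chart set \<Rightarrow> ('m \<Rightarrow> real) set" where
  "smooth_funs A = {f. \<forall>(U, \<phi>)\<in>A. smooth_on (\<phi> ` U) (f \<circ> inv_into U \<phi>)}"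


section \<open>Vector fields and pseudo-Riemannian geometry\<close>

text \<open>Tangent vectors are derivations at a point of the algebra of smooth functions, and a vector
  field \<open>X\<close> sends a smooth function \<open>f\<close> to the smooth function \<open>X f\<close>. Both are defined on all
  functions and set to zero on non-smooth ones, so that equality in HOL is equality of vectors
  and of vector fields. Sums and products of functions are pointwise, as in
  \<^theory>\<open>HOL-Library.Function_Algebras\<close>.\<close>

definition tangent_space ::
    "('m, 'e::real_inner) chart set \<Rightarrow> 'm \<Rightarrow> (('m \<Rightarrow> real) \<Rightarrow> real) set" where
  "tangent_space A p =
     {v. (\<forall>f\<in>smooth_funs A. \<forall>g\<in>smooth_funs A. v (f + g) = v f + v g) \<and>
         (\<forall>c. \<forall>f\<in>smooth_funs A. v (\<lambda>q. c * f q) = c * v f) \<and>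
         (\<forall>f\<in>smooth_funs A. \<forall>g\<in>smooth_funs A. v (f * g) = v f * g p + f p * v g) \<and>
         (\<forall>f. f \<notin> smooth_funs A \<longrightarrow> v f = 0)}"

type_synonym 'm vfield = "('m \<Rightarrow> real) \<Rightarrow> 'm \<Rightarrow> real"

definition vf_at :: "'m vfield \<Rightarrow> 'm \<Rightarrow> ('m \<Rightarrow> real) \<Rightarrow> real" where
  "vf_at X p = (\<lambda>f. X f p)"

definition vector_fields :: "('m, 'e::real_inner) chart set \<Rightarrow> 'm vfield set" where
  "vector_fields A =
     {X. (\<forall>p. vf_at X p \<in> tangent_space A p) \<and> (\<forall>f\<in>smooth_funs A. X f \<in> smooth_funs A)}"

definition fmul :: "('m \<Rightarrow> real) \<Rightarrow> 'm vfield \<Rightarrow> 'm vfield" where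
  "fmul f X = (\<lambda>g. f * X g)"

definition vf_bracket :: "'m vfield \<Rightarrow> 'm vfield \<Rightarrow> 'm vfield" where
  "vf_bracket X Y = (\<lambda>f. X (Y f) - Y (X f))"

text \<open>Tensor fields of type \<open>(0,2)\<close> and \<open>(1,2)\<close> are bilinear maps over the smooth functions.\<close>

definition pseudo_riemannian_metric ::
    "('m, 'e::real_inner) chart set \<Rightarrow> ('m vfield \<Rightarrow> 'm vfield \<Rightarrow> 'm \<Rightarrow> real) \<Rightarrow> bool" where
  "pseudo_riemannian_metric A g \<longleftrightarrow>
     (\<forall>X\<in>vector_fields A. \<forall>Y\<in>vector_fields A. g X Y \<in> smooth_funs A \<and> g X Y = g Y X) \<and>
     (\<forall>X\<in>vector_fields A. \<forall>Y\<in>vector_fields A. \<forall>Z\<in>vector_fields A.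
        g (X + Y) Z = g X Z + g Y Z) \<and>
     (\<forall>f\<in>smooth_funs A. \<forall>X\<in>vector_fields A. \<forall>Y\<in>vector_fields A.
        g (fmul f X) Y = f * g X Y) \<and>
     (\<forall>p. \<forall>X\<in>vector_fields A. (\<forall>Y\<in>vector_fields A. g X Y p = 0) \<longrightarrow> vf_at X p = 0)"

definition tensor_field_12 ::
    "('m, 'e::real_inner) chart set \<Rightarrow> ('m vfield \<Rightarrow> 'm vfield \<Rightarrow> 'm vfield) \<Rightarrow> bool" where
  "tensor_field_12 A T \<longleftrightarrow>
     (\<forall>X\<in>vector_fields A. \<forall>Y\<in>vector_fields A. T X Y \<in> vector_fields A) \<and>
     (\<forall>X\<in>vector_fields A. \<forall>Y\<in>vector_fields A. \<forall>Z\<in>vector_fields A.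
        T (X + Y) Z = T X Z + T Y Z \<and> T Z (X + Y) = T Z X + T Z Y) \<and>
     (\<forall>f\<in>smooth_funs A. \<forall>X\<in>vector_fields A. \<forall>Y\<in>vector_fields A.
        T (fmul f X) Y = fmul f (T X Y) \<and> T X (fmul f Y) = fmul f (T X Y))"

definition affine_connection ::
    "('m, 'e::real_inner) chart set \<Rightarrow> ('m vfield \<Rightarrow> 'm vfield \<Rightarrow> 'm vfield) \<Rightarrow> bool" where
  "affine_connection A D \<longleftrightarrow>
     (\<forall>X\<in>vector_fields A. \<forall>Y\<in>vector_fields A. D X Y \<in> vector_fields A) \<and>
     (\<forall>X\<in>vector_fields A. \<forall>Y\<in>vector_fields A. \<forall>Z\<in>vector_fields A.
        D (X + Y) Z = D X Z + D Y Z \<and> D Z (X + Y) = D Z X + D Z Y) \<and>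
     (\<forall>f\<in>smooth_funs A. \<forall>X\<in>vector_fields A. \<forall>Y\<in>vector_fields A.
        D (fmul f X) Y = fmul f (D X Y) \<and> D X (fmul f Y) = fmul (X f) Y + fmul f (D X Y))"

definition levi_civita ::
    "('m, 'e::real_inner) chart set \<Rightarrow> ('m vfield \<Rightarrow> 'm vfield \<Rightarrow> 'm \<Rightarrow> real)
      \<Rightarrow> ('m vfield \<Rightarrow> 'm vfield \<Rightarrow> 'm vfield) \<Rightarrow> bool" where
  "levi_civita A g D \<longleftrightarrow>
     affine_connection A D \<and>
     (\<forall>X\<in>vector_fields A. \<forall>Y\<in>vector_fields A. D X Y - D Y X = vf_bracket X Y) \<and>
     (\<forall>X\<in>vector_fields A. \<forall>Y\<in>vector_fields A. \<forall>Z\<in>vector_fields A.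
        X (g Y Z) = g (D X Y) Z + g Y (D X Z))"

definition curvature ::
    "('m vfield \<Rightarrow> 'm vfield \<Rightarrow> 'm vfield)
      \<Rightarrow> 'm vfield \<Rightarrow> 'm vfield \<Rightarrow> 'm vfield \<Rightarrow> 'm vfield" where
  "curvature D X Y W = D X (D Y W) - D Y (D X W) - D (vf_bracket X Y) W"

definition cov_deriv_curvature ::
    "('m vfield \<Rightarrow> 'm vfield \<Rightarrow> 'm vfield)
      \<Rightarrow> 'm vfield \<Rightarrow> 'm vfield \<Rightarrow> 'm vfield \<Rightarrow> 'm vfield \<Rightarrow> 'm vfield" where
  "cov_deriv_curvature D X Y Z W =
     D X (curvature D Y Z W) - curvature D (D X Y) Z W - curvature D Y (D X Z) W
       - curvature D Y Z (D X W)"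

definition cov_deriv_tensor ::
    "('m vfield \<Rightarrow> 'm vfield \<Rightarrow> 'm vfield) \<Rightarrow> ('m vfield \<Rightarrow> 'm vfield \<Rightarrow> 'm vfield)
      \<Rightarrow> 'm vfield \<Rightarrow> 'm vfield \<Rightarrow> 'm vfield \<Rightarrow> 'm vfield" where
  "cov_deriv_tensor D T X Y W = D X (T Y W) - T (D X Y) W - T Y (D X W)"

text \<open>Here \<open>D\<close> is the Levi-Civita connection, which is unique on the vector fields. The equations
  between endomorphisms of the tangent bundle are evaluated on a vector field \<open>W\<close>.\<close>

definition naturally_reductive_structure ::
    "('m::{t2_space, second_countable_topology}, 'e::real_inner) chart set
      \<Rightarrow> ('m vfield \<Rightarrow> 'm vfield \<Rightarrow> 'm \<Rightarrow> real)
      \<Rightarrow> ('m vfield \<Rightarrow> 'm vfield \<Rightarrow> 'm vfield) \<Rightarrow> bool" where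
  "naturally_reductive_structure A g T \<longleftrightarrow>
     smooth_manifold A \<and> connected (UNIV :: 'm set) \<and> simply_connected (UNIV :: 'm set) \<and>
     pseudo_riemannian_metric A g \<and> tensor_field_12 A T \<and>
     (\<exists>D. levi_civita A g D \<and>
       (\<forall>X\<in>vector_fields A. \<forall>Y\<in>vector_fields A. \<forall>Z\<in>vector_fields A.
          g (T X Y) Z + g Y (T X Z) = 0) \<and>
       (\<forall>X\<in>vector_fields A. \<forall>Y\<in>vector_fields A. \<forall>Z\<in>vector_fields A. \<forall>W\<in>vector_fields A.
          cov_deriv_curvature D X Y Z W =
            T X (curvature D Y Z W) - curvature D Y Z (T X W)
              - curvature D (T X Y) Z W - curvature D Y (T X Z) W) \<and>
       (\<forall>X\<in>vector_fields A. \<forall>Y\<in>vector_fields A. \<forall>W\<in>vector_fields A.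
          cov_deriv_tensor D T X Y W = T X (T Y W) - T Y (T X W) - T (T X Y) W) \<and>
       (\<forall>X\<in>vector_fields A. T X X = 0))"


section \<open>Lie groups and left translation\<close>

definition lie_group ::
    "('g::{t2_space, second_countable_topology}, 'e::real_inner) chart set
      \<Rightarrow> ('g \<Rightarrow> 'g \<Rightarrow> 'g) \<Rightarrow> 'g \<Rightarrow> ('g \<Rightarrow> 'g) \<Rightarrow> bool" where
  "lie_group A mul e iv \<longleftrightarrow>
     smooth_manifold A \<and> group mul e iv \<and>
     smooth_map (prod_atlas A A) A (\<lambda>(a, b). mul a b) \<and> smooth_map A A iv"

definition left_invariant_fields ::
    "('g, 'e::real_inner) chart set \<Rightarrow> ('g \<Rightarrow> 'g \<Rightarrow> 'g) \<Rightarrow> 'g vfield set" where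
  "left_invariant_fields A mul =
     {X \<in> vector_fields A. \<forall>a p. \<forall>f\<in>smooth_funs A. X (f \<circ> mul a) p = X f (mul a p)}"

text \<open>The Lie algebra of a Lie group is the tangent space at the identity, with the bracket of
  left-invariant extensions. An identification of a Lie algebra with it is given by the map \<open>\<iota>\<close>
  sending \<open>x\<close> to the left-invariant extension of the tangent vector at the identity
  that corresponds to \<open>x\<close>.\<close>

definition is_lie_algebra_of ::
    "('g, 'e::real_inner) chart set \<Rightarrow> ('g \<Rightarrow> 'g \<Rightarrow> 'g) \<Rightarrow> 'g
      \<Rightarrow> ('a::real_vector \<Rightarrow> 'a \<Rightarrow> 'a) \<Rightarrow> ('a \<Rightarrow> 'g vfield) \<Rightarrow> bool" where
  "is_lie_algebra_of A mul e br \<iota> \<longleftrightarrow>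
     (\<forall>x. \<iota> x \<in> left_invariant_fields A mul) \<and>
     (\<forall>x y. \<iota> (x + y) = \<iota> x + \<iota> y) \<and>
     (\<forall>c x. \<iota> (c *\<^sub>R x) = fmul (\<lambda>_. c) (\<iota> x)) \<and>
     (\<forall>x y. \<iota> (br x y) = vf_bracket (\<iota> x) (\<iota> y)) \<and>
     bij_betw (\<lambda>x. vf_at (\<iota> x) e) UNIV (tangent_space A e)"

text \<open>The vector \<open>X\<^sub>p\<close> translated back to the identity, as an element of the Lie algebra: the
  value of \<open>\<iota> x\<close> at \<open>p\<close> is the left translate by \<open>p\<close> of its value at the identity.\<close>

definition left_triv :: "('a \<Rightarrow> 'g vfield) \<Rightarrow> 'g vfield \<Rightarrow> 'g \<Rightarrow> 'a" where
  "left_triv \<iota> X p = (THE x. vf_at (\<iota> x) p = vf_at X p)"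

definition left_metric ::
    "('a \<Rightarrow> 'g vfield) \<Rightarrow> ('a \<Rightarrow> 'a \<Rightarrow> real) \<Rightarrow> 'g vfield \<Rightarrow> 'g vfield \<Rightarrow> 'g \<Rightarrow> real" where
  "left_metric \<iota> B X Y = (\<lambda>p. B (left_triv \<iota> X p) (left_triv \<iota> Y p))"

definition left_tensor ::
    "('a \<Rightarrow> 'g vfield) \<Rightarrow> ('a \<Rightarrow> 'a \<Rightarrow> 'a) \<Rightarrow> 'g vfield \<Rightarrow> 'g vfield \<Rightarrow> 'g vfield" where
  "left_tensor \<iota> t X Y = (\<lambda>f p. \<iota> (t (left_triv \<iota> X p) (left_triv \<iota> Y p)) f p)"

end

theory Submission
  imports Defs
begin

text \<open>
  The metric and the tensor \<open>T\<close> have constant coefficients in the frame of left-invariant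
  fields, so the claim is a statement about the Lie algebra \<open>V = \<G>(\<dd>)\<close> once vector fields have
  been replaced by \<open>V\<close>-valued functions.

  On \<open>V\<close>, let \<open>\<gamma>\<close> be the product given by the Koszul formula (\<open>lc_product\<close>), which is the
  Levi-Civita connection on left-invariant fields. Then \<open>\<gamma>(x + h\<^sup>*, \<cdot>) - T(x + h\<^sup>*, \<cdot>)\<close> is
  \<open>-\<rho>(h)\<close> with \<open>\<rho>(h)(y + k\<^sup>*) = \<pi>(h)y + [h, k]\<^sup>*\<close> (\<open>isotropy_eq\<close>). This is the point of the
  choice of \<open>T\<close>: each \<open>\<rho>(h)\<close> is a skew derivation of the Lie algebra \<open>V\<close>, which rests on the
  equivariance of \<open>\<beta>\<close> (\<open>beta_equivariant\<close>), hence a derivation of everything built from bracket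
  and metric, such as \<open>\<gamma>\<close> and the curvature, and by the Jacobi identity of \<open>\<hh>\<close> also of \<open>T\<close>.
  Equivalently, the connection \<open>\<nabla> - T\<close> makes the curvature and \<open>T\<close> parallel, which is what the
  two differential conditions of a naturally reductive structure say. Skewness and \<open>T\<^sub>XX = 0\<close> are
  short computations.

  To pass from \<open>V\<close> to all vector fields, write \<open>u\<close>, \<open>v\<close> for the \<open>V\<close>-valued functions that represent
  \<open>X\<close>, \<open>Y\<close> in the frame, and \<open>X\<cdot>v\<close> for the componentwise derivative. Then \<open>[X, Y]\<close> is represented
  by \<open>X\<cdot>v - Y\<cdot>u + [u, v]\<close> and \<open>\<nabla>\<^sub>XY\<close> by \<open>X\<cdot>v + \<gamma>(u, v)\<close>. Constant multilinear maps satisfy the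
  Leibniz rule, so in the curvature and in the covariant derivatives of \<open>T\<close> and of the curvature
  all derivatives of component functions cancel and the identities of \<open>V\<close> remain
  (\<open>naturally_reductive_left_tensor\<close>).

  Two analytic facts make this work. The left-invariant fields form a basis of the tangent space at
  every point, because left translations preserve smooth functions (\<open>lie_group_frame\<close>). And the
  components of a vector field in this frame are smooth (\<open>smooth_valued_left_triv\<close>), although a
  vector field is only known to map smooth functions to smooth functions; this is an elimination
  argument on germs of functions (\<open>smooth_coefficients\<close>).
\<close>

section \<open>Calculus of smooth functions\<close>

lemma C_k_on_has_derivative:
  assumes "C_k_on (Suc k) S f" "x \<in> S"
  shows "(f has_derivative frechet_derivative f (at x)) (at x)"
  using assms frechet_derivative_works by fastforce

lemma C_k_on_SucD: "C_k_on (Suc k) S f \<Longrightarrow> C_k_on k S f"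
proof (induction k arbitrary: f)
  case 0
  then show ?case
    by (auto intro!: continuous_at_imp_continuous_on differentiable_imp_continuous_within)
next
  case (Suc k)
  then show ?case by (metis C_k_on.simps(2))
qed

lemma C_k_on_subset: "C_k_on k S f \<Longrightarrow> S' \<subseteq> S \<Longrightarrow> C_k_on k S' f"
  by (induction k arbitrary: f) (auto intro: continuous_on_subset)

text \<open>A derivative depends only on the germ of the function, so on an open set the agreement passes to
all derivatives.\<close>

lemma C_k_on_cong:
  assumes "open S" "\<And>x. x \<in> S \<Longrightarrow> f x = g x" "C_k_on k S f"
  shows "C_k_on k S g"
  using assms(2,3)
proof (induction k arbitrary: f g)
  case 0
  then show ?case by (simp cong: continuous_on_cong)
next
  case (Suc k)
  have D: "(g has_derivative frechet_derivative f (at x)) (at x)" if "x \<in> S" for x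
    using has_derivative_transform_within_open[OF C_k_on_has_derivative[OF Suc.prems(2) that]
        assms(1) that] Suc.prems(1) by blast
  have "C_k_on k S (\<lambda>x. frechet_derivative g (at x) v)" for v
  proof (rule Suc.IH)
    show "C_k_on k S (\<lambda>x. frechet_derivative f (at x) v)"
      using Suc.prems(2) by simp
    show "frechet_derivative f (at x) v = frechet_derivative g (at x) v" if "x \<in> S" for x
      by (simp flip: frechet_derivative_at[OF D[OF that]])
  qed
  then show ?case
    using D by (auto simp: differentiable_def)
qed

text \<open>With this rule a smoothness proof may use any formula that represents the derivative on \<open>S\<close>, in
place of the \<open>frechet_derivative\<close> of the definition.\<close>

lemma C_k_on_SucI:
  assumes "open S" "\<And>x. x \<in> S \<Longrightarrow> (f has_derivative f' x) (at x)"
    and "\<And>v. C_k_on k S (\<lambda>x. f' x v)"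
  shows "C_k_on (Suc k) S f"
proof -
  have "C_k_on k S (\<lambda>x. frechet_derivative f (at x) v)" for v
  proof (rule C_k_on_cong[OF assms(1) _ assms(3)[of v]])
    show "f' x v = frechet_derivative f (at x) v" if "x \<in> S" for x
      by (simp flip: frechet_derivative_at[OF assms(2)[OF that]])
  qed
  then show ?thesis
    using assms(2) by (auto simp: differentiable_def)
qed

lemma C_k_on_local:
  assumes "\<And>x. x \<in> S \<Longrightarrow> \<exists>N. open N \<and> x \<in> N \<and> C_k_on k N f"
  shows "C_k_on k S f"
  using assms
proof (induction k arbitrary: f)
  case 0
  have "isCont f x" if "x \<in> S" for x
    using 0[OF that] by (auto simp: continuous_on_eq_continuous_at)
  then show ?case by (simp add: continuous_at_imp_continuous_on)
next
  case (Suc k)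
  have "C_k_on k S (\<lambda>x. frechet_derivative f (at x) v)" for v
    using Suc.prems by (intro Suc.IH) (metis C_k_on.simps(2))
  moreover have "f differentiable (at x)" if "x \<in> S" for x
    using Suc.prems[OF that] by auto
  ultimately show ?case by simp
qed

lemma C_k_on_const: "C_k_on k S (\<lambda>_. c)"
  by (induction k arbitrary: c) simp_all

lemma C_k_on_bounded_linear:
  assumes "open S" "bounded_linear L" "C_k_on k S f"
  shows "C_k_on k S (\<lambda>x. L (f x))"
  using assms(3)
proof (induction k arbitrary: f)
  case 0
  then show ?case
    using bounded_linear.continuous_on[OF assms(2)] by simp
next
  case (Suc k)
  show ?case
  proof (rule C_k_on_SucI[OF assms(1)])
    show "((\<lambda>x. L (f x)) has_derivative (\<lambda>v. L (frechet_derivative f (at x) v))) (at x)"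
      if "x \<in> S" for x
      using bounded_linear.has_derivative[OF assms(2) C_k_on_has_derivative[OF Suc.prems that]] .
    show "C_k_on k S (\<lambda>x. L (frechet_derivative f (at x) v))" for v
      using Suc by simp
  qed
qed

lemma C_k_on_add:
  assumes "open S" "C_k_on k S f" "C_k_on k S g"
  shows "C_k_on k S (\<lambda>x. f x + g x)"
  using assms(2,3)
proof (induction k arbitrary: f g)
  case 0
  then show ?case by (simp add: continuous_on_add)
next
  case (Suc k)
  show ?case
  proof (rule C_k_on_SucI[OF assms(1)])
    show "((\<lambda>x. f x + g x) has_derivative
        (\<lambda>v. frechet_derivative f (at x) v + frechet_derivative g (at x) v)) (at x)"
      if "x \<in> S" for x
      using C_k_on_has_derivative[OF Suc.prems(1) that] C_k_on_has_derivative[OF Suc.prems(2) that]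
      by (rule has_derivative_add)
    show "C_k_on k S (\<lambda>x. frechet_derivative f (at x) v + frechet_derivative g (at x) v)" for v
      using Suc by simp
  qed
qed

lemma C_k_on_sum:
  assumes "open S" "\<And>i. i \<in> I \<Longrightarrow> C_k_on k S (f i)"
  shows "C_k_on k S (\<lambda>x. \<Sum>i\<in>I. f i x)"
  using assms(2)
  by (induction I rule: infinite_finite_induct)
    (auto intro: C_k_on_const C_k_on_add[OF assms(1)])

lemma C_k_on_mult:
  fixes f g :: "'a::real_normed_vector \<Rightarrow> real"
  assumes "open S" "C_k_on k S f" "C_k_on k S g"
  shows "C_k_on k S (\<lambda>x. f x * g x)"
  using assms(2,3)
proof (induction k arbitrary: f g)
  case 0
  then show ?case by (simp add: continuous_on_mult)
next
  case (Suc k)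
  show ?case
  proof (rule C_k_on_SucI[OF assms(1)])
    show "((\<lambda>x. f x * g x) has_derivative
        (\<lambda>v. f x * frechet_derivative g (at x) v + frechet_derivative f (at x) v * g x)) (at x)"
      if "x \<in> S" for x
      using C_k_on_has_derivative[OF Suc.prems(1) that] C_k_on_has_derivative[OF Suc.prems(2) that]
      by (rule has_derivative_mult)
    show "C_k_on k S (\<lambda>x. f x * frechet_derivative g (at x) v + frechet_derivative f (at x) v * g x)"
      for v
      using Suc C_k_on_SucD[OF Suc.prems(1)] C_k_on_SucD[OF Suc.prems(2)]
      by (intro C_k_on_add[OF assms(1)] Suc.IH) auto
  qed
qed

lemma C_k_on_inverse:
  fixes f :: "'a::real_normed_vector \<Rightarrow> real"
  assumes "open S" "\<And>x. x \<in> S \<Longrightarrow> f x \<noteq> 0" "C_k_on k S f"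
  shows "C_k_on k S (\<lambda>x. inverse (f x))"
  using assms(3)
proof (induction k)
  case 0
  then show ?case using assms(2) by (auto intro!: continuous_on_inverse)
next
  case (Suc k)
  show ?case
  proof (rule C_k_on_SucI[OF assms(1)])
    show "((\<lambda>x. inverse (f x)) has_derivative
        (\<lambda>v. - 1 * (inverse (f x) * frechet_derivative f (at x) v * inverse (f x)))) (at x)"
      if "x \<in> S" for x
      using Deriv.has_derivative_inverse[OF assms(2)[OF that] C_k_on_has_derivative[OF Suc.prems that]]
      by simp
    show "C_k_on k S (\<lambda>x. - 1 * (inverse (f x) * frechet_derivative f (at x) v * inverse (f x)))" for v
      using Suc.prems Suc.IH[OF C_k_on_SucD[OF Suc.prems]]
      by (intro C_k_on_mult[OF assms(1)] C_k_on_const) auto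
  qed
qed

text \<open>The model space of a manifold carries no distinguished basis. An orthogonal spanning set supplies
coordinate functionals that are visibly continuous. The set may contain \<open>0\<close>, whose coefficient is
then \<open>0\<close> by the convention for division.\<close>

lemma finite_orthogonal_expansion:
  assumes "fin_dim TYPE('a)"
  obtains C :: "'a::real_inner set" where "finite C"
    and "\<And>y. y = (\<Sum>c\<in>C. (y \<bullet> c / (c \<bullet> c)) *\<^sub>R c)"
proof -
  obtain B :: "'a set" where B: "finite B" "span B = UNIV"
    using assms by (auto simp: fin_dim_def)
  obtain C where C: "finite C" "span C = span B" "pairwise orthogonal C"
    using basis_orthogonal[OF B(1)] by blast
  have "y = (\<Sum>c\<in>C. (y \<bullet> c / (c \<bullet> c)) *\<^sub>R c)" for y
  proof -
    have "y \<in> span C" using B C by simp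
    then obtain u where u: "y = (\<Sum>c\<in>C. u c *\<^sub>R c)"
      using real_vector.span_finite[OF C(1)] by auto
    have coeff: "(y \<bullet> c / (c \<bullet> c)) *\<^sub>R c = u c *\<^sub>R c" if "c \<in> C" for c
    proof -
      have "y \<bullet> c = (\<Sum>d\<in>C. u d * (d \<bullet> c))"
        by (simp add: u inner_sum_left)
      also have "\<dots> = (\<Sum>d\<in>C. if d = c then u c * (c \<bullet> c) else 0)"
        using C(3) that by (intro sum.cong) (auto simp: pairwise_def orthogonal_def)
      also have "\<dots> = u c * (c \<bullet> c)" using C(1) that by simp
      finally show ?thesis by (cases "c = 0") auto
    qed
    have "(\<Sum>c\<in>C. u c *\<^sub>R c) = (\<Sum>c\<in>C. (y \<bullet> c / (c \<bullet> c)) *\<^sub>R c)"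
      by (rule sum.cong[OF refl coeff[symmetric]])
    then show ?thesis using u by (rule trans[rotated])
  qed
  then show ?thesis using that C(1) by blast
qed

text \<open>Expanding the inner derivative in coordinates turns the chain rule into
\<open>(F \<circ> G)'(x) v = (\<Sum>c. (coordinate of G'(x) v) * F'(G x) c)\<close>, a sum of products of scalar functions,
so the induction on the order of differentiability uses only sums, products and composition with
the partial derivatives of \<open>F\<close>.\<close>

lemma C_k_on_compose:
  fixes F :: "'b::real_inner \<Rightarrow> real" and G :: "'a::real_normed_vector \<Rightarrow> 'b"
  assumes "fin_dim TYPE('b)" "open S" "G ` S \<subseteq> U" "C_k_on k U F" "C_k_on k S G"
  shows "C_k_on k S (\<lambda>x. F (G x))"
  using assms(4,5)
proof (induction k arbitrary: F)
  case 0
  then show ?case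
    using continuous_on_compose2[of U F S G] assms(3) by auto
next
  case (Suc k)
  obtain C :: "'b set" where C: "finite C" "\<And>y. y = (\<Sum>c\<in>C. (y \<bullet> c / (c \<bullet> c)) *\<^sub>R c)"
    using finite_orthogonal_expansion[OF assms(1)] by blast
  define F' G' where "F' = (\<lambda>x. frechet_derivative F (at x))"
    and "G' = (\<lambda>x. frechet_derivative G (at x))"
  show ?case
  proof (rule C_k_on_SucI[OF assms(2)])
    show "((\<lambda>x. F (G x)) has_derivative
        (\<lambda>v. \<Sum>c\<in>C. ((G' x v \<bullet> c) * (1 / (c \<bullet> c))) * F' (G x) c)) (at x)" if "x \<in> S" for x
    proof -
      have dF: "(F has_derivative F' (G x)) (at (G x))"
        using C_k_on_has_derivative[OF Suc.prems(1)] assms(3) that by (auto simp: F'_def)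
      have "((\<lambda>x. F (G x)) has_derivative (\<lambda>v. F' (G x) (G' x v))) (at x)"
        using has_derivative_compose[OF C_k_on_has_derivative[OF Suc.prems(2) that] dF]
        by (simp add: G'_def)
      moreover have "F' (G x) (G' x v) =
          (\<Sum>c\<in>C. ((G' x v \<bullet> c) * (1 / (c \<bullet> c))) * F' (G x) c)" for v
      proof -
        have lin: "linear (F' (G x))"
          using dF has_derivative_linear by blast
        have "F' (G x) (G' x v) = F' (G x) (\<Sum>c\<in>C. (G' x v \<bullet> c / (c \<bullet> c)) *\<^sub>R c)"
          using C(2) by simp
        then show ?thesis
          by (simp add: linear_sum[OF lin] linear_scale[OF lin])
      qed
      ultimately show ?thesis by simp
    qed
    show "C_k_on k S (\<lambda>x. \<Sum>c\<in>C. ((G' x v \<bullet> c) * (1 / (c \<bullet> c))) * F' (G x) c)" for v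
    proof (intro C_k_on_sum C_k_on_mult C_k_on_const assms(2))
      show "C_k_on k S (\<lambda>x. G' x v \<bullet> c)" for c
        using C_k_on_bounded_linear[OF assms(2) bounded_linear_inner_left, of k "\<lambda>x. G' x v" c]
          Suc.prems(2) by (simp add: G'_def)
      show "C_k_on k S (\<lambda>x. F' (G x) c)" for c
        using Suc.IH[of "\<lambda>y. F' y c"] Suc.prems(1) C_k_on_SucD[OF Suc.prems(2)]
        by (simp add: F'_def)
    qed
  qed
qed

text \<open>Freezing the first argument: the smoothness of the multiplication of a Lie group is joint in both
factors, and left translations are its restrictions to slices.\<close>

lemma C_k_on_slice:
  assumes "open S" "C_k_on k S F"
  shows "C_k_on k {x. (c, x) \<in> S} (\<lambda>x. F (c, x))"
  using assms(2)
proof (induction k arbitrary: F)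
  case 0
  then show ?case
    by (auto intro!: continuous_on_compose2[of S F] continuous_intros)
next
  case (Suc k)
  have op: "open {x. (c, x) \<in> S}"
    using open_vimage[OF assms(1), of "Pair c"] by (simp add: vimage_def continuous_on_Pair)
  show ?case
  proof (rule C_k_on_SucI[OF op])
    show "((\<lambda>x. F (c, x)) has_derivative (\<lambda>v. frechet_derivative F (at (c, x)) (0, v))) (at x)"
      if "x \<in> {x. (c, x) \<in> S}" for x
    proof -
      have "((\<lambda>x. (c, x)) has_derivative (\<lambda>v. (0, v))) (at x)"
        using has_derivative_Pair[OF has_derivative_const has_derivative_ident] .
      from has_derivative_compose[OF this C_k_on_has_derivative[OF Suc.prems]] that
      show ?thesis by simp
    qed
    show "C_k_on k {x. (c, x) \<in> S} (\<lambda>x. frechet_derivative F (at (c, x)) (0, v))" for v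
      using Suc.prems by (intro Suc.IH[of "\<lambda>y. frechet_derivative F (at y) (0, v)"]) simp
  qed
qed

lemma smooth_on_const: "smooth_on S (\<lambda>_. c)"
  by (simp add: smooth_on_def C_k_on_const)

lemma smooth_on_subset: "smooth_on S f \<Longrightarrow> S' \<subseteq> S \<Longrightarrow> smooth_on S' f"
  unfolding smooth_on_def by (blast intro: C_k_on_subset)

lemma smooth_on_cong: "open S \<Longrightarrow> (\<And>x. x \<in> S \<Longrightarrow> f x = g x) \<Longrightarrow> smooth_on S f \<Longrightarrow> smooth_on S g"
  unfolding smooth_on_def by (metis C_k_on_cong)

lemma smooth_on_add:
  "open S \<Longrightarrow> smooth_on S f \<Longrightarrow> smooth_on S g \<Longrightarrow> smooth_on S (\<lambda>x. f x + g x)"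
  by (simp add: smooth_on_def C_k_on_add)

lemma smooth_on_mult:
  fixes f g :: "'a::real_normed_vector \<Rightarrow> real"
  shows "open S \<Longrightarrow> smooth_on S f \<Longrightarrow> smooth_on S g \<Longrightarrow> smooth_on S (\<lambda>x. f x * g x)"
  by (simp add: smooth_on_def C_k_on_mult)

lemma smooth_on_imp_continuous_on: "smooth_on S f \<Longrightarrow> continuous_on S f"
  by (metis C_k_on.simps(1) smooth_on_def)

text \<open>Germs at \<open>p\<close> of smooth functions. They form a ring in which every element with nonzero value at
\<open>p\<close> is invertible, and they are insensitive to changes away from \<open>p\<close>.\<close>

definition smooth_near :: "'a::real_normed_vector \<Rightarrow> ('a \<Rightarrow> real) \<Rightarrow> bool" where
  "smooth_near p f \<longleftrightarrow> (\<exists>N. open N \<and> p \<in> N \<and> smooth_on N f)"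

lemma smooth_on_if_smooth_near: "(\<And>x. x \<in> S \<Longrightarrow> smooth_near x f) \<Longrightarrow> smooth_on S f"
  unfolding smooth_on_def smooth_near_def by (meson C_k_on_local)

lemma smooth_nearI: "smooth_on S f \<Longrightarrow> open S \<Longrightarrow> p \<in> S \<Longrightarrow> smooth_near p f"
  by (auto simp: smooth_near_def)

lemma smooth_near_const: "smooth_near p (\<lambda>_. c)"
  using smooth_nearI[OF smooth_on_const open_UNIV] by simp

lemma smooth_near_pair:
  assumes "smooth_near p f" "smooth_near p g"
  obtains N where "open N" "p \<in> N" "smooth_on N f" "smooth_on N g"
proof -
  obtain M N where "open M" "p \<in> M" "smooth_on M f" "open N" "p \<in> N" "smooth_on N g"
    using assms by (auto simp: smooth_near_def)
  then show ?thesis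
    using that[of "M \<inter> N"] smooth_on_subset[of _ _ "M \<inter> N"] by blast
qed

lemma smooth_near_add:
  assumes "smooth_near p f" "smooth_near p g"
  shows "smooth_near p (\<lambda>x. f x + g x)"
  using smooth_near_pair[OF assms] by (metis smooth_nearI smooth_on_add)

lemma smooth_near_mult:
  assumes "smooth_near p f" "smooth_near p g"
  shows "smooth_near p (\<lambda>x. f x * g x)"
  using smooth_near_pair[OF assms] by (metis smooth_nearI smooth_on_mult)

lemma smooth_near_diff:
  assumes "smooth_near p f" "smooth_near p g"
  shows "smooth_near p (\<lambda>x. f x - g x)"
  using smooth_near_add[OF assms(1) smooth_near_mult[OF smooth_near_const[of p "-1"] assms(2)]]
  by simp

lemma smooth_near_sum:
  "(\<And>i. i \<in> I \<Longrightarrow> smooth_near p (f i)) \<Longrightarrow> smooth_near p (\<lambda>x. \<Sum>i\<in>I. f i x)"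
  by (induction I rule: infinite_finite_induct) (auto intro: smooth_near_const smooth_near_add)

lemma smooth_near_eventually_nonzero:
  assumes "smooth_near p f" "f p \<noteq> 0"
  shows "\<forall>\<^sub>F x in nhds p. f x \<noteq> 0"
proof -
  obtain N where N: "open N" "p \<in> N" "smooth_on N f"
    using assms(1) by (auto simp: smooth_near_def)
  then have "isCont f p"
    using smooth_on_imp_continuous_on continuous_on_eq_continuous_at by blast
  then have "filterlim f (nhds (f p)) (nhds p)"
    by (simp add: isCont_def tendsto_at_iff_tendsto_nhds)
  then show ?thesis
    by (rule tendsto_imp_eventually_ne[OF _ assms(2)])
qed

lemma smooth_near_inverse:
  assumes "smooth_near p f" "f p \<noteq> 0"
  shows "smooth_near p (\<lambda>x. inverse (f x))"
proof -
  obtain N where N: "open N" "p \<in> N" "smooth_on N f"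
    using assms(1) by (auto simp: smooth_near_def)
  obtain M where M: "open M" "p \<in> M" "\<And>x. x \<in> M \<Longrightarrow> f x \<noteq> 0"
    using smooth_near_eventually_nonzero[OF assms] by (auto simp: eventually_nhds)
  have "smooth_on (M \<inter> N) (\<lambda>x. inverse (f x))"
    using N M smooth_on_subset[OF N(3), of "M \<inter> N"]
    by (auto simp: smooth_on_def intro!: C_k_on_inverse)
  then show ?thesis using M N by (auto intro: smooth_nearI[of "M \<inter> N"])
qed

lemma smooth_near_cong:
  assumes "\<forall>\<^sub>F x in nhds p. f x = g x" "smooth_near p f"
  shows "smooth_near p g"
proof -
  obtain N where N: "open N" "p \<in> N" "smooth_on N f"
    using assms(2) by (auto simp: smooth_near_def)
  obtain M where M: "open M" "p \<in> M" "\<And>x. x \<in> M \<Longrightarrow> f x = g x"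
    using assms(1) by (auto simp: eventually_nhds)
  have "smooth_on (M \<inter> N) g"
    using N M smooth_on_subset[OF N(3), of "M \<inter> N"]
    by (intro smooth_on_cong[of "M \<inter> N" f g]) auto
  then show ?thesis using M N by (auto intro: smooth_nearI[of "M \<inter> N"])
qed

section \<open>Smoothness of coefficients\<close>

text \<open>Think of \<open>v i\<close> as vector fields and of \<open>\<xi> i\<close> as the components of a vector field that maps the
functions in \<open>S\<close> to smooth ones. If the \<open>v i\<close> are linearly independent at \<open>p\<close>, as functionals on
\<open>S\<close>, then the components are smooth near \<open>p\<close>. The proof is Gaussian elimination over the local ring
of germs: independence provides a function \<open>g\<close> on which \<open>v k\<close> does not vanish at \<open>p\<close>, and
subtracting the multiple \<open>v i g / v k g\<close> of \<open>v k\<close> from the other \<open>v i\<close> removes the unknown \<open>\<xi> k\<close>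
and keeps the independence. Since only functionals occur, no local coordinate functions have to be
extended to globally smooth functions.\<close>

lemma smooth_coefficients:
  fixes \<xi> :: "'i \<Rightarrow> 'e::real_normed_vector \<Rightarrow> real" and v :: "'i \<Rightarrow> 'f \<Rightarrow> 'e \<Rightarrow> real"
  assumes "finite I"
    and "\<And>i f. i \<in> I \<Longrightarrow> f \<in> S \<Longrightarrow> smooth_near p (v i f)"
    and "\<And>f. f \<in> S \<Longrightarrow> smooth_near p (\<lambda>x. \<Sum>i\<in>I. \<xi> i x * v i f x)"
    and "\<And>c. (\<And>f. f \<in> S \<Longrightarrow> (\<Sum>i\<in>I. c i * v i f p) = 0) \<Longrightarrow> \<forall>i\<in>I. c i = 0"
  shows "\<forall>i\<in>I. smooth_near p (\<xi> i)"
  using assms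
proof (induction I arbitrary: v rule: finite_induct)
  case empty
  then show ?case by simp
next
  case (insert k I)
  have "\<exists>f\<in>S. v k f p \<noteq> 0"
  proof (rule ccontr)
    assume H: "\<not> ?thesis"
    have "\<forall>i\<in>insert k I. (if i = k then 1 else 0 :: real) = 0"
    proof (rule insert.prems(3))
      fix f assume "f \<in> S"
      then show "(\<Sum>i\<in>insert k I. (if i = k then 1 else 0) * v i f p) = 0"
        using H insert.hyps by (auto intro!: sum.neutral)
    qed
    then show False by simp
  qed
  then obtain g where g: "g \<in> S" "v k g p \<noteq> 0" by blast
  define q where "q = (\<lambda>x. inverse (v k g x))"
  have q: "smooth_near p q"
    unfolding q_def using g by (intro smooth_near_inverse insert.prems(1)) auto
  have q_inv: "\<forall>\<^sub>F x in nhds p. v k g x * q x = 1"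
    using smooth_near_eventually_nonzero[of p "v k g"] insert.prems(1) g
    by (auto simp: q_def elim: eventually_mono)
  define \<eta> where "\<eta> = (\<lambda>f x. \<Sum>i\<in>insert k I. \<xi> i x * v i f x)"
  have \<eta>: "smooth_near p (\<eta> f)" if "f \<in> S" for f
    unfolding \<eta>_def using insert.prems(2) that by blast
  \<comment> \<open>eliminates \<open>\<xi> k\<close>: \<open>w i\<close> vanishes on the pivot function \<open>g\<close> near \<open>p\<close>\<close>
  define w where "w = (\<lambda>i f x. v i f x - v i g x * q x * v k f x)"
  have I: "\<forall>i\<in>I. smooth_near p (\<xi> i)"
  proof (rule insert.IH)
    show "smooth_near p (w i f)" if "i \<in> I" "f \<in> S" for i f
      unfolding w_def using that g q insert.prems(1)
      by (intro smooth_near_diff smooth_near_mult) auto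
    show "smooth_near p (\<lambda>x. \<Sum>i\<in>I. \<xi> i x * w i f x)" if f: "f \<in> S" for f
    proof (rule smooth_near_cong)
      show "smooth_near p (\<lambda>x. \<eta> f x - \<eta> g x * q x * v k f x)"
        using f g q insert.prems(1) \<eta> by (intro smooth_near_diff smooth_near_mult) auto
      have "\<eta> f x - \<eta> g x * q x * v k f x = (\<Sum>i\<in>I. \<xi> i x * w i f x)"
        if x: "v k g x * q x = 1" for x
      proof -
        have w_x: "(\<Sum>i\<in>I. \<xi> i x * w i f x) =
            (\<Sum>i\<in>I. \<xi> i x * v i f x) - (\<Sum>i\<in>I. \<xi> i x * v i g x) * (q x * v k f x)"
          unfolding w_def by (simp add: right_diff_distrib sum_subtractf sum_distrib_right mult.assoc)
        have \<eta>_x: "\<eta> h x = \<xi> k x * v k h x + (\<Sum>i\<in>I. \<xi> i x * v i h x)" for h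
          using insert.hyps by (simp add: \<eta>_def)
        show ?thesis
          unfolding w_x \<eta>_x[of f] \<eta>_x[of g] using x by algebra
      qed
      then show "\<forall>\<^sub>F x in nhds p. \<eta> f x - \<eta> g x * q x * v k f x = (\<Sum>i\<in>I. \<xi> i x * w i f x)"
        using q_inv by (auto elim: eventually_mono)
    qed
    show "\<forall>i\<in>I. c i = 0" if c: "\<And>f. f \<in> S \<Longrightarrow> (\<Sum>i\<in>I. c i * w i f p) = 0" for c
    proof -
      \<comment> \<open>a relation among the \<open>w i\<close> is a relation among the \<open>v i\<close> with this coefficient at \<open>k\<close>\<close>
      define c' where "c' = c(k := - (\<Sum>i\<in>I. c i * v i g p) * q p)"
      have c'I: "(\<Sum>i\<in>I. c' i * h i) = (\<Sum>i\<in>I. c i * h i)" for h :: "'i \<Rightarrow> real"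
        using insert.hyps by (intro sum.cong) (auto simp: c'_def)
      have "\<forall>i\<in>insert k I. c' i = 0"
      proof (rule insert.prems(3))
        fix f assume f: "f \<in> S"
        have "(\<Sum>i\<in>I. c i * w i f p) =
            (\<Sum>i\<in>I. c i * v i f p) - (\<Sum>i\<in>I. c i * v i g p) * (q p * v k f p)"
          unfolding w_def by (simp add: right_diff_distrib sum_subtractf sum_distrib_right mult.assoc)
        then show "(\<Sum>i\<in>insert k I. c' i * v i f p) = 0"
          using insert.hyps c[OF f] c'I by (simp add: c'_def algebra_simps)
      qed
      then show ?thesis using insert.hyps by (auto simp: c'_def split: if_splits)
    qed
  qed
  have "smooth_near p (\<xi> k)"
  proof (rule smooth_near_cong)
    show "smooth_near p (\<lambda>x. (\<eta> g x - (\<Sum>i\<in>I. \<xi> i x * v i g x)) * q x)"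
      using I g q \<eta> insert.prems(1)
      by (intro smooth_near_diff smooth_near_mult smooth_near_sum) auto
    have "(\<eta> g x - (\<Sum>i\<in>I. \<xi> i x * v i g x)) * q x = \<xi> k x" if "v k g x * q x = 1" for x
      using insert.hyps that by (simp add: \<eta>_def)
    then show "\<forall>\<^sub>F x in nhds p. (\<eta> g x - (\<Sum>i\<in>I. \<xi> i x * v i g x)) * q x = \<xi> k x"
      using q_inv by (auto elim: eventually_mono)
  qed
  then show ?case using I by simp
qed

section \<open>Vector fields and vector-valued functions\<close>

lemma fin_dim_basis:
  assumes "fin_dim TYPE('a::real_vector)"
  shows "\<exists>B::'a set. finite B \<and> independent B \<and> span B = UNIV"
proof -
  obtain S :: "'a set" where S: "finite S" "span S = UNIV"
    using assms by (auto simp: fin_dim_def)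
  obtain B where B: "B \<subseteq> S" "independent B" "S \<subseteq> span B"
    using real_vector.maximal_independent_subset[of S] by blast
  then have "span B = UNIV"
    using S(2) real_vector.span_minimal[OF B(3) real_vector.subspace_span[of B]] by auto
  then show ?thesis using B(1,2) finite_subset[OF B(1) S(1)] by auto
qed

definition fin_basis :: "'a::real_vector set" where
  "fin_basis = (SOME B. finite B \<and> independent B \<and> span B = UNIV)"

definition coord :: "'a::real_vector \<Rightarrow> 'a \<Rightarrow> real" where
  "coord b x = representation fin_basis x b"

context
  assumes fin: "fin_dim TYPE('a::real_vector)"
begin

lemma fin_basis:
  "finite (fin_basis :: 'a set)" "independent (fin_basis :: 'a set)" "span (fin_basis :: 'a set) = UNIV"
  using someI_ex[OF fin_dim_basis[OF fin]] by (simp_all add: fin_basis_def)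

lemma linear_coord: "linear (coord (b::'a))"
  unfolding coord_def
  by (rule linearI)
    (simp_all add: real_vector.representation_add real_vector.representation_scale fin_basis)

lemma coord_expansion: "(x::'a) = (\<Sum>b\<in>fin_basis. coord b x *\<^sub>R b)"
  unfolding coord_def
  using real_vector.sum_representation_eq[OF fin_basis(2), of x fin_basis] fin_basis by simp

lemma linear_expansion:
  assumes "linear (L :: 'a \<Rightarrow> 'b::real_vector)"
  shows "L x = (\<Sum>b\<in>fin_basis. coord b x *\<^sub>R L b)"
  by (subst coord_expansion[of x]) (simp add: linear_sum[OF assms] linear_scale[OF assms])

lemma eq_if_functionals_eq:
  assumes "\<And>l :: 'a \<Rightarrow> real. linear l \<Longrightarrow> l x = l y"
  shows "x = y"
  by (subst coord_expansion[of x], subst coord_expansion[of y]) (simp add: assms[OF linear_coord])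

lemma coord_coefficients:
  assumes "b \<in> (fin_basis :: 'a set)"
  shows "coord b (\<Sum>a\<in>fin_basis. c a *\<^sub>R a) = c b"
proof -
  have "coord b (\<Sum>a\<in>fin_basis. c a *\<^sub>R a) = (\<Sum>a\<in>fin_basis. c a * coord b a)"
    by (simp add: linear_sum[OF linear_coord] linear_scale[OF linear_coord])
  also have "\<dots> = (\<Sum>a\<in>fin_basis. if a = b then c a else 0)"
    using fin_basis by (intro sum.cong) (auto simp: coord_def real_vector.representation_basis)
  finally show ?thesis using fin_basis assms by simp
qed

end

lemma chart_facts:
  assumes "smooth_manifold A" "(U, \<phi>) \<in> A"
  shows "open U" "open (\<phi> ` U)" "inj_on \<phi> U" "homeomorphism U (\<phi> ` U) \<phi> (inv_into U \<phi>)"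
proof -
  have "is_chart (U, \<phi>)" using assms by (auto simp: smooth_manifold_def)
  then show "open U" "open (\<phi> ` U)" and h: "homeomorphism U (\<phi> ` U) \<phi> (inv_into U \<phi>)"
    by (auto simp: is_chart_def)
  show "inj_on \<phi> U"
    using homeomorphism_apply1[OF h] by (rule inj_on_inverseI)
qed

lemma smooth_funs_iff_smooth_near:
  assumes "smooth_manifold A"
  shows "f \<in> smooth_funs A \<longleftrightarrow>
    (\<forall>(U, \<phi>)\<in>A. \<forall>x\<in>\<phi> ` U. smooth_near x (f \<circ> inv_into U \<phi>))"
proof
  assume "f \<in> smooth_funs A"
  then show "\<forall>(U, \<phi>)\<in>A. \<forall>x\<in>\<phi> ` U. smooth_near x (f \<circ> inv_into U \<phi>)"
    using chart_facts(2)[OF assms]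
    by (auto simp: smooth_funs_def intro!: smooth_nearI)
next
  assume H: "\<forall>(U, \<phi>)\<in>A. \<forall>x\<in>\<phi> ` U. smooth_near x (f \<circ> inv_into U \<phi>)"
  have "smooth_on (\<phi> ` U) (f \<circ> inv_into U \<phi>)" if "(U, \<phi>) \<in> A" for U \<phi>
    by (rule smooth_on_if_smooth_near) (use H that in blast)
  then show "f \<in> smooth_funs A" by (auto simp: smooth_funs_def)
qed

lemma smooth_funs_const: "(\<lambda>_. c) \<in> smooth_funs A"
  by (auto simp: smooth_funs_def comp_def smooth_on_const)

lemma smooth_funs_add:
  assumes "smooth_manifold A" "f \<in> smooth_funs A" "g \<in> smooth_funs A"
  shows "(\<lambda>p. f p + g p) \<in> smooth_funs A"
  using assms chart_facts(2)[OF assms(1)]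
  by (auto simp: smooth_funs_def comp_def intro!: smooth_on_add split: prod.splits)

lemma smooth_funs_mult:
  assumes "smooth_manifold A" "f \<in> smooth_funs A" "g \<in> smooth_funs A"
  shows "(\<lambda>p. f p * g p) \<in> smooth_funs A"
  using assms chart_facts(2)[OF assms(1)]
  by (auto simp: smooth_funs_def comp_def intro!: smooth_on_mult split: prod.splits)

lemma smooth_funs_sum:
  assumes "smooth_manifold A" "\<And>i. i \<in> I \<Longrightarrow> f i \<in> smooth_funs A"
  shows "(\<lambda>p. \<Sum>i\<in>I. f i p) \<in> smooth_funs A"
  using assms(2)
  by (induction I rule: infinite_finite_induct)
    (auto intro: smooth_funs_const smooth_funs_add[OF assms(1)])

context
  fixes A :: "('g::{t2_space, second_countable_topology}, 'e::real_inner) chart set"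
  assumes man: "smooth_manifold A"
begin

context
  fixes X :: "'g vfield"
  assumes X: "X \<in> vector_fields A"
begin

lemma vf_smooth: "f \<in> smooth_funs A \<Longrightarrow> X f \<in> smooth_funs A"
  using X by (simp add: vector_fields_def)

lemma vf_tangent: "vf_at X p \<in> tangent_space A p"
  using X by (simp add: vector_fields_def)

lemma vf_add:
  "f \<in> smooth_funs A \<Longrightarrow> g \<in> smooth_funs A \<Longrightarrow> X (\<lambda>q. f q + g q) p = X f p + X g p"
  using vf_tangent[of p] by (auto simp: tangent_space_def vf_at_def plus_fun_def)

lemma vf_mult:
  "f \<in> smooth_funs A \<Longrightarrow> g \<in> smooth_funs A \<Longrightarrow>
    X (\<lambda>q. f q * g q) p = X f p * g p + f p * X g p"
  using vf_tangent[of p] by (auto simp: tangent_space_def vf_at_def times_fun_def)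

lemma vf_cmult: "f \<in> smooth_funs A \<Longrightarrow> X (\<lambda>q. c * f q) p = c * X f p"
  using vf_tangent[of p] by (auto simp: tangent_space_def vf_at_def)

lemma vf_nonsmooth: "f \<notin> smooth_funs A \<Longrightarrow> X f p = 0"
  using vf_tangent[of p] by (auto simp: tangent_space_def vf_at_def)

lemma vf_zero: "X (\<lambda>_. 0) p = 0"
  using vf_cmult[OF smooth_funs_const[of 0], of 0] by simp

lemma vf_sum:
  "(\<And>i. i \<in> I \<Longrightarrow> f i \<in> smooth_funs A) \<Longrightarrow> X (\<lambda>q. \<Sum>i\<in>I. f i q) p = (\<Sum>i\<in>I. X (f i) p)"
  by (induction I rule: infinite_finite_induct)
    (auto simp: vf_zero vf_add smooth_funs_sum[OF man])

end

end

text \<open>Smoothness is tested by linear functionals, since the finite-dimensional vector spaces in question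
carry no norm.\<close>

definition smooth_valued :: "('m, 'e::real_inner) chart set \<Rightarrow> ('m \<Rightarrow> 'a::real_vector) \<Rightarrow> bool" where
  "smooth_valued A u \<longleftrightarrow> (\<forall>l. linear l \<longrightarrow> (\<lambda>p. l (u p)) \<in> smooth_funs A)"

lemma smooth_valuedD: "smooth_valued A u \<Longrightarrow> linear l \<Longrightarrow> (\<lambda>p. l (u p)) \<in> smooth_funs A"
  by (simp add: smooth_valued_def)

lemma smooth_valued_const: "smooth_valued A (\<lambda>_. c)"
  by (simp add: smooth_valued_def smooth_funs_const)

lemma smooth_valued_linear:
  fixes L :: "'a::real_vector \<Rightarrow> 'b::real_vector"
  shows "smooth_valued A u \<Longrightarrow> linear L \<Longrightarrow> smooth_valued A (\<lambda>p. L (u p))"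
  unfolding smooth_valued_def
proof (intro allI impI)
  fix l :: "'b \<Rightarrow> real"
  assume u: "\<forall>l. linear l \<longrightarrow> (\<lambda>p. l (u p)) \<in> smooth_funs A" and L: "linear L" "linear l"
  show "(\<lambda>p. l (L (u p))) \<in> smooth_funs A"
    using u[rule_format, OF linear_compose[OF L]] by (simp add: comp_def)
qed

lemma smooth_valued_add:
  assumes "smooth_manifold A" "smooth_valued A u" "smooth_valued A v"
  shows "smooth_valued A (\<lambda>p. u p + v p)"
  using assms by (auto simp: smooth_valued_def linear_add intro!: smooth_funs_add)

lemma smooth_valued_scale:
  assumes "smooth_manifold A" "f \<in> smooth_funs A" "smooth_valued A u"
  shows "smooth_valued A (\<lambda>p. f p *\<^sub>R u p)"
  using assms by (auto simp: smooth_valued_def linear_scale intro!: smooth_funs_mult)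

lemma smooth_valued_diff:
  assumes "smooth_manifold A" "smooth_valued A u" "smooth_valued A v"
  shows "smooth_valued A (\<lambda>p. u p - v p)"
  using smooth_valued_add[OF assms(1,2) smooth_valued_scale[OF assms(1) smooth_funs_const assms(3), of "-1"]]
  by simp

lemma smooth_valued_sum:
  assumes "smooth_manifold A" "\<And>i. i \<in> I \<Longrightarrow> smooth_valued A (u i)"
  shows "smooth_valued A (\<lambda>p. \<Sum>i\<in>I. u i p)"
  using assms(2)
  by (induction I rule: infinite_finite_induct)
    (auto intro: smooth_valued_const smooth_valued_add[OF assms(1)])

lemma smooth_valued_bilinear:
  fixes \<beta> :: "'a::real_vector \<Rightarrow> 'b::real_vector \<Rightarrow> 'c::real_vector"
  assumes "smooth_manifold A" "fin_dim TYPE('a)" "bilinear \<beta>" "smooth_valued A u" "smooth_valued A v"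
  shows "smooth_valued A (\<lambda>p. \<beta> (u p) (v p))"
proof -
  have lin: "linear (\<lambda>x. \<beta> x y)" "linear (\<beta> x)" for x y
    using assms(3) by (auto simp: bilinear_def)
  have "smooth_valued A (\<lambda>p. \<Sum>b\<in>fin_basis. coord b (u p) *\<^sub>R \<beta> b (v p))"
    by (intro smooth_valued_sum smooth_valued_scale assms(1)
        smooth_valuedD[OF assms(4) linear_coord[OF assms(2)]]
        smooth_valued_linear[OF assms(5) lin(2)])
  then show ?thesis
    by (simp flip: linear_expansion[OF assms(2) lin(1)])
qed

text \<open>The componentwise derivative of a vector-valued function along a vector field. It does not depend
on the basis: by the next lemma it is the vector whose image under each linear functional \<open>l\<close> is
the derivative of \<open>l \<circ> u\<close>.\<close>

definition dir_deriv :: "'m vfield \<Rightarrow> ('m \<Rightarrow> 'a::real_vector) \<Rightarrow> 'm \<Rightarrow> 'a" where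
  "dir_deriv X u p = (\<Sum>b\<in>fin_basis. X (\<lambda>q. coord b (u q)) p *\<^sub>R b)"

context
  fixes A :: "('g::{t2_space, second_countable_topology}, 'e::real_inner) chart set"
  assumes man: "smooth_manifold A" and fin: "fin_dim TYPE('a::real_vector)"
begin

lemma dir_deriv_functional:
  fixes u :: "'g \<Rightarrow> 'a"
  assumes "X \<in> vector_fields A" "smooth_valued A u" "linear l"
  shows "l (dir_deriv X u p) = X (\<lambda>q. l (u q)) p"
proof -
  have c: "(\<lambda>q. coord b (u q)) \<in> smooth_funs A" for b
    using assms(2) linear_coord[OF fin] by (rule smooth_valuedD)
  have "X (\<lambda>q. l (u q)) p = X (\<lambda>q. \<Sum>b\<in>fin_basis. l b * coord b (u q)) p"
    by (subst linear_expansion[OF fin assms(3)]) (simp add: mult.commute)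
  also have "\<dots> = (\<Sum>b\<in>fin_basis. l b * X (\<lambda>q. coord b (u q)) p)"
    using c by (subst vf_sum[OF man assms(1)])
      (auto simp: vf_cmult[OF man assms(1)] intro!: smooth_funs_mult[OF man] smooth_funs_const)
  finally show ?thesis
    by (simp add: dir_deriv_def linear_sum[OF assms(3)] linear_scale[OF assms(3)] mult.commute)
qed

lemma smooth_valued_dir_deriv:
  fixes u :: "'g \<Rightarrow> 'a"
  assumes "X \<in> vector_fields A" "smooth_valued A u"
  shows "smooth_valued A (dir_deriv X u)"
  using assms by (auto simp: smooth_valued_def dir_deriv_functional vf_smooth[OF man])

lemma dir_deriv_eqI:
  fixes u :: "'g \<Rightarrow> 'a"
  assumes "X \<in> vector_fields A" "smooth_valued A u" "\<And>l. linear l \<Longrightarrow> X (\<lambda>q. l (u q)) p = l y"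
  shows "dir_deriv X u p = y"
  using assms by (intro eq_if_functionals_eq[OF fin]) (simp add: dir_deriv_functional)

lemma dir_deriv_add:
  fixes u v :: "'g \<Rightarrow> 'a"
  assumes "X \<in> vector_fields A" "smooth_valued A u" "smooth_valued A v"
  shows "dir_deriv X (\<lambda>p. u p + v p) p = dir_deriv X u p + dir_deriv X v p"
proof (rule dir_deriv_eqI[OF assms(1) smooth_valued_add[OF man assms(2,3)]])
  fix l :: "'a \<Rightarrow> real" assume l: "linear l"
  show "X (\<lambda>q. l (u q + v q)) p = l (dir_deriv X u p + dir_deriv X v p)"
    using assms
    by (simp add: linear_add[OF l] dir_deriv_functional[OF _ _ l]
        vf_add[OF man _ smooth_valuedD[OF _ l] smooth_valuedD[OF _ l]])
qed

lemma dir_deriv_scale: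
  fixes u :: "'g \<Rightarrow> 'a"
  assumes "X \<in> vector_fields A" "f \<in> smooth_funs A" "smooth_valued A u"
  shows "dir_deriv X (\<lambda>p. f p *\<^sub>R u p) p = X f p *\<^sub>R u p + f p *\<^sub>R dir_deriv X u p"
proof (rule dir_deriv_eqI[OF assms(1) smooth_valued_scale[OF man assms(2,3)]])
  fix l :: "'a \<Rightarrow> real" assume l: "linear l"
  show "X (\<lambda>q. l (f q *\<^sub>R u q)) p = l (X f p *\<^sub>R u p + f p *\<^sub>R dir_deriv X u p)"
    using assms
    by (simp add: linear_add[OF l] linear_scale[OF l] dir_deriv_functional[OF _ _ l]
        vf_mult[OF man _ _ smooth_valuedD[OF _ l]])
qed

lemma dir_deriv_diff:
  fixes u v :: "'g \<Rightarrow> 'a"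
  assumes "X \<in> vector_fields A" "smooth_valued A u" "smooth_valued A v"
  shows "dir_deriv X (\<lambda>p. u p - v p) p = dir_deriv X u p - dir_deriv X v p"
proof -
  have "dir_deriv X (\<lambda>p. (u p - v p) + v p) p = dir_deriv X (\<lambda>p. u p - v p) p + dir_deriv X v p"
    using assms by (intro dir_deriv_add smooth_valued_diff[OF man])
  then show ?thesis by simp
qed

lemma derivative_bilinear_real:
  fixes u :: "'g \<Rightarrow> 'a" and v :: "'g \<Rightarrow> 'a" and \<beta> :: "'a \<Rightarrow> 'a \<Rightarrow> real"
  assumes "X \<in> vector_fields A" "smooth_valued A u" "smooth_valued A v" "bilinear \<beta>"
  shows "X (\<lambda>p. \<beta> (u p) (v p)) p = \<beta> (dir_deriv X u p) (v p) + \<beta> (u p) (dir_deriv X v p)"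
proof -
  have lin: "linear (\<lambda>x. \<beta> x y)" "linear (\<beta> x)" for x y
    using assms(4) by (auto simp: bilinear_def)
  have c: "(\<lambda>q. coord b (u q)) \<in> smooth_funs A" for b
    using assms(2) linear_coord[OF fin] by (rule smooth_valuedD)
  have d: "(\<lambda>q. \<beta> b (v q)) \<in> smooth_funs A" for b
    using assms(3) lin(2) by (rule smooth_valuedD)
  \<comment> \<open>expanding only \<open>u\<close> suffices, as \<open>\<beta> b\<close> is already a linear functional of \<open>v\<close>\<close>
  have "X (\<lambda>p. \<beta> (u p) (v p)) p = X (\<lambda>p. \<Sum>b\<in>fin_basis. coord b (u p) * \<beta> b (v p)) p"
    by (subst linear_expansion[OF fin lin(1)]) simp
  also have "\<dots> = (\<Sum>b\<in>fin_basis. X (\<lambda>q. coord b (u q)) p * \<beta> b (v p)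
      + coord b (u p) * \<beta> b (dir_deriv X v p))"
    using assms(1,3)
    by (subst vf_sum[OF man assms(1)])
      (simp_all add: smooth_funs_mult[OF man c d] vf_mult[OF man _ c d] dir_deriv_functional[OF _ _ lin(2)])
  also have "\<dots> = \<beta> (dir_deriv X u p) (v p) + \<beta> (u p) (dir_deriv X v p)"
    using linear_expansion[OF fin lin(1), of "u p" "dir_deriv X v p"]
    by (simp add: sum.distrib dir_deriv_def linear_sum[OF lin(1)] linear_scale[OF lin(1)])
  finally show ?thesis .
qed

lemma dir_deriv_bilinear:
  fixes u :: "'g \<Rightarrow> 'a" and v :: "'g \<Rightarrow> 'a" and \<beta> :: "'a \<Rightarrow> 'a \<Rightarrow> 'a"
  assumes "X \<in> vector_fields A" "smooth_valued A u" "smooth_valued A v" "bilinear \<beta>"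
  shows "dir_deriv X (\<lambda>p. \<beta> (u p) (v p)) p = \<beta> (dir_deriv X u p) (v p) + \<beta> (u p) (dir_deriv X v p)"
proof (rule dir_deriv_eqI)
  fix l :: "'a \<Rightarrow> real" assume l: "linear l"
  have "bilinear (\<lambda>x y. l (\<beta> x y))"
    using assms(4) by (auto simp: bilinear_def intro: linear_compose[OF _ l, unfolded comp_def])
  from derivative_bilinear_real[OF assms(1-3) this]
  show "X (\<lambda>q. l (\<beta> (u q) (v q))) p = l (\<beta> (dir_deriv X u p) (v p) + \<beta> (u p) (dir_deriv X v p))"
    by (simp add: linear_add[OF l])
qed (use assms smooth_valued_bilinear[OF man fin] in auto)

end

lemma dir_deriv_add_field: "dir_deriv (X + Y) u p = dir_deriv X u p + dir_deriv Y u p"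
  by (simp add: dir_deriv_def scaleR_left_distrib sum.distrib)

lemma dir_deriv_fmul: "dir_deriv (fmul f X) u p = f p *\<^sub>R dir_deriv X u p"
  by (simp add: dir_deriv_def fmul_def scaleR_sum_right)

section \<open>Manifolds with a global frame\<close>

text \<open>A trivialization of the tangent bundle by a vector space of vector fields. For such a frame
\<open>left_triv \<iota> X p\<close> is the vector of components of \<open>X\<close> at \<open>p\<close>, whether or not the frame comes from a
Lie group.\<close>

locale global_frame =
  fixes A :: "('g::{t2_space, second_countable_topology}, 'e::real_inner) chart set"
    and \<iota> :: "'a::real_vector \<Rightarrow> 'g vfield"
  assumes man: "smooth_manifold A"
    and fin: "fin_dim TYPE('a)"
    and frame_vf: "\<And>x. \<iota> x \<in> vector_fields A"
    and frame_add: "\<And>x y. \<iota> (x + y) = \<iota> x + \<iota> y"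
    and frame_scale: "\<And>c x. \<iota> (c *\<^sub>R x) = fmul (\<lambda>_. c) (\<iota> x)"
    and frame_bij: "\<And>p. bij_betw (\<lambda>x. vf_at (\<iota> x) p) UNIV (tangent_space A p)"
begin

lemma linear_frame: "linear (\<lambda>x. \<iota> x f p)"
  by (rule linearI) (simp_all add: frame_add frame_scale fmul_def)

lemma left_triv_eqI:
  assumes "vf_at (\<iota> x) p = vf_at X p"
  shows "left_triv \<iota> X p = x"
  unfolding left_triv_def
proof (rule the_equality[where P = "\<lambda>x. vf_at (\<iota> x) p = vf_at X p", OF assms])
  fix y assume "vf_at (\<iota> y) p = vf_at X p"
  then show "y = x"
    using assms injD[OF bij_betw_imp_inj_on[OF frame_bij[of p]]] by metis
qed

lemma frame_left_triv:
  assumes "X \<in> vector_fields A"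
  shows "\<iota> (left_triv \<iota> X p) f p = X f p"
proof -
  obtain x where "vf_at (\<iota> x) p = vf_at X p"
    using bij_betw_imp_surj_on[OF frame_bij[of p]] vf_tangent[OF man assms, of p]
    unfolding image_iff set_eq_iff by metis
  then show ?thesis
    using left_triv_eqI[of x p X] by (metis vf_at_def)
qed

lemma frame_expansion:
  assumes "X \<in> vector_fields A"
  shows "X f p = (\<Sum>b\<in>fin_basis. coord b (left_triv \<iota> X p) * \<iota> b f p)"
  using linear_expansion[OF fin linear_frame, of "left_triv \<iota> X p" f p]
  by (simp add: frame_left_triv[OF assms])

definition field_of :: "('g \<Rightarrow> 'a) \<Rightarrow> 'g vfield" where
  "field_of u = (\<lambda>f p. \<iota> (u p) f p)"

lemma left_triv_field_of: "left_triv \<iota> (field_of u) = u"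
  by (intro ext left_triv_eqI) (simp add: field_of_def vf_at_def)

lemma left_triv_frame: "left_triv \<iota> (\<iota> x) p = x"
  by (intro left_triv_eqI) simp

lemma field_of_vf:
  assumes "smooth_valued A u"
  shows "field_of u \<in> vector_fields A"
proof -
  have "field_of u f \<in> smooth_funs A" if "f \<in> smooth_funs A" for f
  proof -
    have "(\<lambda>p. \<Sum>b\<in>fin_basis. coord b (u p) * \<iota> b f p) \<in> smooth_funs A"
      by (intro smooth_funs_sum smooth_funs_mult man smooth_valuedD[OF assms linear_coord[OF fin]]
          vf_smooth[OF man frame_vf that])
    moreover have "field_of u f = (\<lambda>p. \<Sum>b\<in>fin_basis. coord b (u p) * \<iota> b f p)"
      unfolding field_of_def
      by (intro ext) (subst linear_expansion[OF fin linear_frame], simp)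
    ultimately show ?thesis by simp
  qed
  moreover have "vf_at (field_of u) p = vf_at (\<iota> (u p)) p" for p
    by (simp add: vf_at_def field_of_def)
  ultimately show ?thesis
    using vf_tangent[OF man frame_vf] by (simp add: vector_fields_def)
qed

text \<open>In a chart, the derivatives of smooth functions along \<open>X\<close> are known smooth combinations of the
unknown components, and the frame fields are independent at each point, so
\<open>smooth_coefficients\<close> applies.\<close>

lemma smooth_valued_left_triv:
  assumes X: "X \<in> vector_fields A"
  shows "smooth_valued A (left_triv \<iota> X)"
proof -
  have c: "(\<lambda>p. coord b (left_triv \<iota> X p)) \<in> smooth_funs A" if b: "b \<in> fin_basis" for b
    unfolding smooth_funs_iff_smooth_near[OF man]
  proof (safe)
    fix U \<phi> p assume ch: "(U, \<phi>) \<in> A" and p: "p \<in> U"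
    have near: "smooth_near (\<phi> p) (\<lambda>x. f (inv_into U \<phi> x))" if "f \<in> smooth_funs A" for f
      using that ch p unfolding smooth_funs_iff_smooth_near[OF man] comp_def by blast
    have inv: "inv_into U \<phi> (\<phi> p) = p"
      using chart_facts(3)[OF man ch] p by simp
    have "\<forall>b\<in>fin_basis. smooth_near (\<phi> p) (\<lambda>x. coord b (left_triv \<iota> X (inv_into U \<phi> x)))"
    proof (rule smooth_coefficients[where v = "\<lambda>b f x. \<iota> b f (inv_into U \<phi> x)" and S = "smooth_funs A"])
      show "finite (fin_basis :: 'a set)" by (rule fin_basis(1)[OF fin])
      show "smooth_near (\<phi> p) (\<lambda>x. \<iota> b f (inv_into U \<phi> x))" if "f \<in> smooth_funs A" for b f
        using near vf_smooth[OF man frame_vf that] by blast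
      show "smooth_near (\<phi> p) (\<lambda>x. \<Sum>b\<in>fin_basis.
          coord b (left_triv \<iota> X (inv_into U \<phi> x)) * \<iota> b f (inv_into U \<phi> x))"
        if f: "f \<in> smooth_funs A" for f
      proof -
        have "(\<lambda>x. \<Sum>b\<in>fin_basis. coord b (left_triv \<iota> X (inv_into U \<phi> x)) * \<iota> b f (inv_into U \<phi> x))
            = (\<lambda>x. X f (inv_into U \<phi> x))"
          by (intro ext) (rule frame_expansion[OF X, symmetric])
        then show ?thesis using near[OF vf_smooth[OF man X f]] by simp
      qed
      show "\<forall>b\<in>fin_basis. c b = 0"
        if H: "\<And>f. f \<in> smooth_funs A \<Longrightarrow> (\<Sum>b\<in>fin_basis. c b * \<iota> b f (inv_into U \<phi> (\<phi> p))) = 0"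
        for c :: "'a \<Rightarrow> real"
      proof -
        define y where "y = (\<Sum>b\<in>fin_basis. c b *\<^sub>R b)"
        have "\<iota> y f p = \<iota> 0 f p" for f
        proof (cases "f \<in> smooth_funs A")
          case True
          have "\<iota> y f p = (\<Sum>b\<in>fin_basis. c b * \<iota> b f p)"
            unfolding y_def by (simp add: linear_sum[OF linear_frame] linear_scale[OF linear_frame])
          then show ?thesis using H[OF True] linear_0[OF linear_frame] by (simp add: inv)
        qed (simp add: vf_nonsmooth[OF man frame_vf])
        then have "vf_at (\<iota> y) p = vf_at (\<iota> 0) p" by (simp add: vf_at_def)
        then have "y = 0"
          using injD[OF bij_betw_imp_inj_on[OF frame_bij[of p]]] by metis
        then show ?thesis
          using coord_coefficients[OF fin, of _ c] linear_0[OF linear_coord[OF fin]]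
          by (simp add: y_def)
      qed
    qed
    then show "smooth_near (\<phi> p) ((\<lambda>p. coord b (left_triv \<iota> X p)) \<circ> inv_into U \<phi>)"
      using b by (simp add: comp_def)
  qed
  have "smooth_valued A (\<lambda>p. \<Sum>b\<in>fin_basis. coord b (left_triv \<iota> X p) *\<^sub>R b)"
    using c by (intro smooth_valued_sum smooth_valued_scale smooth_valued_const man)
  then show ?thesis by (simp flip: coord_expansion[OF fin])
qed

lemma add_eq_field_of:
  "X \<in> vector_fields A \<Longrightarrow> Y \<in> vector_fields A \<Longrightarrow>
    X + Y = field_of (\<lambda>p. left_triv \<iota> X p + left_triv \<iota> Y p)"
  by (intro ext) (simp add: field_of_def linear_add[OF linear_frame] frame_left_triv)

lemma diff_eq_field_of:
  "X \<in> vector_fields A \<Longrightarrow> Y \<in> vector_fields A \<Longrightarrow>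
    X - Y = field_of (\<lambda>p. left_triv \<iota> X p - left_triv \<iota> Y p)"
  by (intro ext) (simp add: field_of_def linear_diff[OF linear_frame] frame_left_triv)

lemma fmul_eq_field_of:
  "X \<in> vector_fields A \<Longrightarrow> fmul f X = field_of (\<lambda>p. f p *\<^sub>R left_triv \<iota> X p)"
  by (intro ext) (simp add: field_of_def fmul_def linear_scale[OF linear_frame] frame_left_triv)

lemmas left_triv_simps =
  left_triv_field_of
  add_eq_field_of[THEN arg_cong[of _ _ "left_triv \<iota>"], unfolded left_triv_field_of]
  diff_eq_field_of[THEN arg_cong[of _ _ "left_triv \<iota>"], unfolded left_triv_field_of]
  fmul_eq_field_of[THEN arg_cong[of _ _ "left_triv \<iota>"], unfolded left_triv_field_of]

lemma field_of_add: "field_of (\<lambda>p. u p + v p) = field_of u + field_of v"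
  by (intro ext) (simp add: field_of_def linear_add[OF linear_frame])

lemma field_of_diff: "field_of (\<lambda>p. u p - v p) = field_of u - field_of v"
  by (intro ext) (simp add: field_of_def linear_diff[OF linear_frame])

lemma field_of_scale: "field_of (\<lambda>p. f p *\<^sub>R u p) = fmul f (field_of u)"
  by (intro ext) (simp add: field_of_def fmul_def linear_scale[OF linear_frame])

text \<open>Differentiating \<open>Y f\<close>, with \<open>Y\<close> expanded in the frame, produces one term in which the components of
\<open>Y\<close> are differentiated and one in which they are treated as constants. The second term is the only
one that survives for two frame fields, whence the formula for brackets of arbitrary fields.\<close>

lemma second_derivative:
  assumes X: "X \<in> vector_fields A" and Y: "Y \<in> vector_fields A" and f: "f \<in> smooth_funs A"
  shows "X (Y f) p = \<iota> (dir_deriv X (left_triv \<iota> Y) p) f p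
    + \<iota> (left_triv \<iota> X p) (\<iota> (left_triv \<iota> Y p) f) p"
proof -
  have c: "(\<lambda>q. coord b (left_triv \<iota> Y q)) \<in> smooth_funs A" for b
    using smooth_valued_left_triv[OF Y] linear_coord[OF fin] by (rule smooth_valuedD)
  have d: "\<iota> b f \<in> smooth_funs A" for b
    using vf_smooth[OF man frame_vf f] .
  have lin: "linear (\<lambda>z. \<iota> x (\<iota> z f) p)" for x
  proof (rule linearI)
    show "\<iota> x (\<iota> (y + z) f) p = \<iota> x (\<iota> y f) p + \<iota> x (\<iota> z f) p" for y z
      using vf_add[OF man frame_vf d d] by (simp add: frame_add plus_fun_def)
    show "\<iota> x (\<iota> (r *\<^sub>R y) f) p = r *\<^sub>R \<iota> x (\<iota> y f) p" for r y
      using vf_cmult[OF man frame_vf d] by (simp add: frame_scale fmul_def times_fun_def)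
  qed
  have "Y f = (\<lambda>q. \<Sum>b\<in>fin_basis. coord b (left_triv \<iota> Y q) * \<iota> b f q)"
    by (intro ext) (rule frame_expansion[OF Y])
  then have "X (Y f) p = (\<Sum>b\<in>fin_basis. X (\<lambda>q. coord b (left_triv \<iota> Y q)) p * \<iota> b f p
      + coord b (left_triv \<iota> Y p) * X (\<iota> b f) p)"
    by (simp add: vf_sum[OF man X] smooth_funs_mult[OF man c d] vf_mult[OF man X c d])
  also have "\<dots> = (\<Sum>b\<in>fin_basis. X (\<lambda>q. coord b (left_triv \<iota> Y q)) p * \<iota> b f p)
      + (\<Sum>b\<in>fin_basis. coord b (left_triv \<iota> Y p) * \<iota> (left_triv \<iota> X p) (\<iota> b f) p)"
    by (simp add: sum.distrib frame_left_triv[OF X])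
  also have "(\<Sum>b\<in>fin_basis. X (\<lambda>q. coord b (left_triv \<iota> Y q)) p * \<iota> b f p)
      = \<iota> (dir_deriv X (left_triv \<iota> Y) p) f p"
    by (simp add: dir_deriv_def linear_sum[OF linear_frame] linear_scale[OF linear_frame])
  also have "(\<Sum>b\<in>fin_basis. coord b (left_triv \<iota> Y p) * \<iota> (left_triv \<iota> X p) (\<iota> b f) p)
      = \<iota> (left_triv \<iota> X p) (\<iota> (left_triv \<iota> Y p) f) p"
    using linear_expansion[OF fin lin, of "left_triv \<iota> X p" "left_triv \<iota> Y p"] by simp
  finally show ?thesis .
qed

end

section \<open>Frames closed under the bracket\<close>

locale lie_frame = global_frame A \<iota>
  for A :: "('g::{t2_space, second_countable_topology}, 'e::real_inner) chart set"
    and \<iota> :: "'a::real_vector \<Rightarrow> 'g vfield" +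
  fixes br :: "'a \<Rightarrow> 'a \<Rightarrow> 'a"
  assumes br_bilinear: "bilinear br"
    and frame_bracket: "\<And>x y. \<iota> (br x y) = vf_bracket (\<iota> x) (\<iota> y)"
begin

abbreviation triv where "triv \<equiv> left_triv \<iota>"

lemma vf_bracket_eq_field_of:
  assumes X: "X \<in> vector_fields A" and Y: "Y \<in> vector_fields A"
  shows "vf_bracket X Y =
    field_of (\<lambda>p. dir_deriv X (triv Y) p - dir_deriv Y (triv X) p + br (triv X p) (triv Y p))"
proof (intro ext)
  fix f p
  show "vf_bracket X Y f p =
    field_of (\<lambda>p. dir_deriv X (triv Y) p - dir_deriv Y (triv X) p + br (triv X p) (triv Y p)) f p"
  proof (cases "f \<in> smooth_funs A")
    case True
    then show ?thesis
      using second_derivative[OF X Y True, of p] second_derivative[OF Y X True, of p]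
      by (simp add: vf_bracket_def field_of_def frame_bracket linear_add[OF linear_frame]
          linear_diff[OF linear_frame])
  next
    case False
    then have "X f = (\<lambda>_. 0)" "Y f = (\<lambda>_. 0)"
      using vf_nonsmooth[OF man X] vf_nonsmooth[OF man Y] by auto
    then show ?thesis
      using False
      by (simp add: vf_bracket_def field_of_def vf_nonsmooth[OF man frame_vf]
          vf_zero[OF man X] vf_zero[OF man Y])
  qed
qed

lemma smooth_valued_bracket:
  assumes "X \<in> vector_fields A" "Y \<in> vector_fields A"
  shows "smooth_valued A
    (\<lambda>p. dir_deriv X (triv Y) p - dir_deriv Y (triv X) p + br (triv X p) (triv Y p))"
  using assms
  by (intro smooth_valued_add smooth_valued_diff smooth_valued_bilinear[OF man fin br_bilinear]
      smooth_valued_dir_deriv[OF man fin] smooth_valued_left_triv man)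

lemma vf_bracket_vf:
  "X \<in> vector_fields A \<Longrightarrow> Y \<in> vector_fields A \<Longrightarrow> vf_bracket X Y \<in> vector_fields A"
  by (simp add: vf_bracket_eq_field_of field_of_vf smooth_valued_bracket)

text \<open>Componentwise differentiation is a flat connection.\<close>

lemma dir_deriv_bracket:
  assumes X: "X \<in> vector_fields A" and Y: "Y \<in> vector_fields A" and u: "smooth_valued A u"
  shows "dir_deriv (vf_bracket X Y) (u :: 'g \<Rightarrow> 'a) p =
    dir_deriv X (dir_deriv Y u) p - dir_deriv Y (dir_deriv X u) p"
proof (rule dir_deriv_eqI[OF man fin vf_bracket_vf[OF X Y] u])
  fix l :: "'a \<Rightarrow> real" assume l: "linear l"
  have "(\<lambda>q. l (dir_deriv Z u q)) = Z (\<lambda>q. l (u q))" if "Z \<in> vector_fields A" for Z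
    by (intro ext) (rule dir_deriv_functional[OF man fin that u l])
  then show "vf_bracket X Y (\<lambda>q. l (u q)) p =
      l (dir_deriv X (dir_deriv Y u) p - dir_deriv Y (dir_deriv X u) p)"
    using X Y u
    by (simp add: vf_bracket_def linear_diff[OF l] smooth_valued_dir_deriv[OF man fin]
        dir_deriv_functional[OF man fin _ _ l])
qed

text \<open>Differentiation of components, corrected by a bilinear product: the connection whose value on frame
fields is \<open>\<nabla>\<^bsub>\<iota> x\<^esub>(\<iota> y) = \<iota> (\<gamma> x y)\<close>.\<close>

definition connection :: "('a \<Rightarrow> 'a \<Rightarrow> 'a) \<Rightarrow> 'g vfield \<Rightarrow> 'g vfield \<Rightarrow> 'g vfield" where
  "connection \<gamma> X Y = field_of (\<lambda>p. dir_deriv X (triv Y) p + \<gamma> (triv X p) (triv Y p))"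

lemma left_tensor_eq_field_of:
  "left_tensor \<iota> t X Y = field_of (\<lambda>p. t (triv X p) (triv Y p))"
  by (simp add: left_tensor_def field_of_def)

lemma left_tensor_vf:
  "bilinear t \<Longrightarrow> X \<in> vector_fields A \<Longrightarrow> Y \<in> vector_fields A \<Longrightarrow>
    left_tensor \<iota> t X Y \<in> vector_fields A"
  unfolding left_tensor_eq_field_of
  by (rule field_of_vf[OF smooth_valued_bilinear[OF man fin _ smooth_valued_left_triv smooth_valued_left_triv]])

lemma tensor_field_left_tensor:
  assumes "bilinear t"
  shows "tensor_field_12 A (left_tensor \<iota> t)"
  using assms
  unfolding tensor_field_12_def
  by (auto simp: left_tensor_vf)
    (auto simp: left_tensor_eq_field_of left_triv_simps bilinear_ladd bilinear_radd
      bilinear_lmul bilinear_rmul field_of_add field_of_scale)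

text \<open>The curvature of the connection with product \<open>\<gamma>\<close>, evaluated on frame fields.\<close>

definition curv :: "('a \<Rightarrow> 'a \<Rightarrow> 'a) \<Rightarrow> 'a \<Rightarrow> 'a \<Rightarrow> 'a \<Rightarrow> 'a" where
  "curv \<gamma> y z w = \<gamma> y (\<gamma> z w) - \<gamma> z (\<gamma> y w) - \<gamma> (br y z) w"

context
  fixes \<gamma> :: "'a \<Rightarrow> 'a \<Rightarrow> 'a"
  assumes \<gamma>: "bilinear \<gamma>"
begin

lemma smooth_valued_connection:
  assumes "X \<in> vector_fields A" "Y \<in> vector_fields A"
  shows "smooth_valued A (\<lambda>p. dir_deriv X (triv Y) p + \<gamma> (triv X p) (triv Y p))"
  using assms
  by (intro smooth_valued_add smooth_valued_bilinear[OF man fin \<gamma>]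
      smooth_valued_dir_deriv[OF man fin] smooth_valued_left_triv man)

lemma connection_vf:
  "X \<in> vector_fields A \<Longrightarrow> Y \<in> vector_fields A \<Longrightarrow> connection \<gamma> X Y \<in> vector_fields A"
  unfolding connection_def by (intro field_of_vf smooth_valued_connection)

lemma left_triv_connection:
  "triv (connection \<gamma> X Y) = (\<lambda>p. dir_deriv X (triv Y) p + \<gamma> (triv X p) (triv Y p))"
  by (simp add: connection_def left_triv_field_of)

lemma affine_connection_connection: "affine_connection A (connection \<gamma>)"
  unfolding affine_connection_def
proof (intro conjI ballI)
  fix X Y Z f
  assume X: "X \<in> vector_fields A" and Y: "Y \<in> vector_fields A" and Z: "Z \<in> vector_fields A"
  show "connection \<gamma> X Y \<in> vector_fields A"
    using X Y by (rule connection_vf)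
  show "connection \<gamma> (X + Y) Z = connection \<gamma> X Z + connection \<gamma> Y Z"
    using X Y Z
    by (simp add: connection_def left_triv_simps dir_deriv_add_field bilinear_ladd[OF \<gamma>] algebra_simps
        flip: field_of_add)
  show "connection \<gamma> Z (X + Y) = connection \<gamma> Z X + connection \<gamma> Z Y"
    using X Y Z
    by (simp add: connection_def left_triv_simps dir_deriv_add[OF man fin] smooth_valued_left_triv
        bilinear_radd[OF \<gamma>] algebra_simps flip: field_of_add)
next
  fix f X Y
  assume f: "f \<in> smooth_funs A" and X: "X \<in> vector_fields A" and Y: "Y \<in> vector_fields A"
  show "connection \<gamma> (fmul f X) Y = fmul f (connection \<gamma> X Y)"
    using X Y
    by (simp add: connection_def left_triv_simps dir_deriv_fmul bilinear_lmul[OF \<gamma>] scaleR_add_right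
        flip: field_of_scale)
  have "fmul (X f) Y = field_of (\<lambda>p. X f p *\<^sub>R triv Y p)"
    using Y by (rule fmul_eq_field_of)
  then show "connection \<gamma> X (fmul f Y) = fmul (X f) Y + fmul f (connection \<gamma> X Y)"
    using X Y f
    by (simp add: connection_def left_triv_simps dir_deriv_scale[OF man fin] smooth_valued_left_triv
        bilinear_rmul[OF \<gamma>] scaleR_add_right add.assoc flip: field_of_scale field_of_add)
qed

text \<open>The derivatives of components contribute exactly the derivative part of the bracket and of the
derivative of the metric, so that torsion-freeness and metricity concern the product alone.\<close>

lemma levi_civita_connection:
  assumes B: "bilinear B"
    and torsion_free: "\<And>x y. \<gamma> x y - \<gamma> y x = br x y"
    and metric: "\<And>x y z. B (\<gamma> x y) z + B y (\<gamma> x z) = 0"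
  shows "levi_civita A (left_metric \<iota> B) (connection \<gamma>)"
  unfolding levi_civita_def
proof (intro conjI ballI affine_connection_connection)
  fix X Y Z
  assume X: "X \<in> vector_fields A" and Y: "Y \<in> vector_fields A"
  have "connection \<gamma> X Y - connection \<gamma> Y X = field_of (\<lambda>p. dir_deriv X (triv Y) p
      - dir_deriv Y (triv X) p + (\<gamma> (triv X p) (triv Y p) - \<gamma> (triv Y p) (triv X p)))"
    unfolding connection_def field_of_diff[symmetric] by (rule arg_cong[of _ _ field_of]) auto
  then show "connection \<gamma> X Y - connection \<gamma> Y X = vf_bracket X Y"
    by (simp add: torsion_free vf_bracket_eq_field_of[OF X Y])
  assume Z: "Z \<in> vector_fields A"
  show "X (left_metric \<iota> B Y Z) =
      left_metric \<iota> B (connection \<gamma> X Y) Z + left_metric \<iota> B Y (connection \<gamma> X Z)"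
  proof
    fix p
    show "X (left_metric \<iota> B Y Z) p =
      (left_metric \<iota> B (connection \<gamma> X Y) Z + left_metric \<iota> B Y (connection \<gamma> X Z)) p"
      using derivative_bilinear_real[OF man fin X smooth_valued_left_triv[OF Y]
          smooth_valued_left_triv[OF Z] B, of p] metric[of "triv X p" "triv Y p" "triv Z p"]
      by (simp add: left_metric_def left_triv_connection bilinear_ladd[OF B] bilinear_radd[OF B])
  qed
qed

text \<open>The second derivatives of the components of \<open>W\<close> cancel because componentwise differentiation is
flat, and the derivatives of the components of \<open>Y\<close> and \<open>Z\<close> cancel against those in \<open>[Y, Z]\<close>.\<close>

lemma curvature_connection:
  assumes Y: "Y \<in> vector_fields A" and Z: "Z \<in> vector_fields A" and W: "W \<in> vector_fields A"
  shows "curvature (connection \<gamma>) Y Z W = field_of (\<lambda>p. curv \<gamma> (triv Y p) (triv Z p) (triv W p))"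
proof -
  have C: "connection \<gamma> Y (connection \<gamma> Z W) = field_of (\<lambda>p. dir_deriv Y (dir_deriv Z (triv W)) p
      + (\<gamma> (dir_deriv Y (triv Z) p) (triv W p) + \<gamma> (triv Z p) (dir_deriv Y (triv W) p))
      + \<gamma> (triv Y p) (dir_deriv Z (triv W) p + \<gamma> (triv Z p) (triv W p)))"
    if "Y \<in> vector_fields A" "Z \<in> vector_fields A" for Y Z
    using that W
    by (simp add: connection_def[of _ Y] left_triv_connection dir_deriv_add[OF man fin]
        dir_deriv_bilinear[OF man fin _ _ _ \<gamma>] smooth_valued_bilinear[OF man fin \<gamma>]
        smooth_valued_dir_deriv[OF man fin] smooth_valued_left_triv)
  have bracket: "triv (vf_bracket Y Z) =
      (\<lambda>p. dir_deriv Y (triv Z) p - dir_deriv Z (triv Y) p + br (triv Y p) (triv Z p))"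
    by (simp add: vf_bracket_eq_field_of[OF Y Z] left_triv_field_of)
  have D: "connection \<gamma> (vf_bracket Y Z) W = field_of (\<lambda>p.
      dir_deriv Y (dir_deriv Z (triv W)) p - dir_deriv Z (dir_deriv Y (triv W)) p
      + \<gamma> (dir_deriv Y (triv Z) p - dir_deriv Z (triv Y) p + br (triv Y p) (triv Z p)) (triv W p))"
    using Y Z W bracket by (simp add: connection_def dir_deriv_bracket smooth_valued_left_triv)
  show ?thesis
    unfolding curvature_def C[OF Y Z] C[OF Z Y] D field_of_diff[symmetric] curv_def
    by (rule arg_cong[of _ _ field_of])
      (simp add: fun_eq_iff bilinear_ladd[OF \<gamma>] bilinear_radd[OF \<gamma>] bilinear_lsub[OF \<gamma>] algebra_simps)
qed

lemma curv_add:
  "curv \<gamma> (x + y) z w = curv \<gamma> x z w + curv \<gamma> y z w"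
  "curv \<gamma> x (y + z) w = curv \<gamma> x y w + curv \<gamma> x z w"
  "curv \<gamma> x y (z + w) = curv \<gamma> x y z + curv \<gamma> x y w"
  by (simp_all add: curv_def bilinear_ladd[OF \<gamma>] bilinear_radd[OF \<gamma>]
      bilinear_ladd[OF br_bilinear] bilinear_radd[OF br_bilinear])

lemma curv_diff:
  "curv \<gamma> (x - y) z w = curv \<gamma> x z w - curv \<gamma> y z w"
  "curv \<gamma> x (y - z) w = curv \<gamma> x y w - curv \<gamma> x z w"
  "curv \<gamma> x y (z - w) = curv \<gamma> x y z - curv \<gamma> x y w"
  using curv_add[of "x - y" y z w] curv_add(2)[of x "y - z" z w] curv_add(3)[of x y "z - w" w]
  by (simp_all add: algebra_simps)

lemma dir_deriv_curv:
  assumes X: "X \<in> vector_fields A"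
    and "smooth_valued A u" "smooth_valued A v" "smooth_valued A w"
  shows "dir_deriv X (\<lambda>p. curv \<gamma> (u p) (v p) (w p)) p =
    curv \<gamma> (dir_deriv X u p) (v p) (w p) + curv \<gamma> (u p) (dir_deriv X v p) (w p)
      + curv \<gamma> (u p) (v p) (dir_deriv X w p)"
  using assms(2-4)
  by (simp add: curv_def dir_deriv_diff[OF man fin X] dir_deriv_bilinear[OF man fin X _ _ \<gamma>]
      dir_deriv_bilinear[OF man fin X _ _ br_bilinear] smooth_valued_bilinear[OF man fin \<gamma>]
      smooth_valued_bilinear[OF man fin br_bilinear] smooth_valued_diff[OF man]
      bilinear_ladd[OF \<gamma>] bilinear_radd[OF \<gamma>])

text \<open>A derivation of a torsion-free product is a derivation of the bracket, which is its commutator, and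
therefore of the curvature.\<close>

lemma derivation_curv:
  assumes D: "linear D"
    and torsion_free: "\<And>x y. \<gamma> x y - \<gamma> y x = br x y"
    and der: "\<And>y z. D (\<gamma> y z) = \<gamma> (D y) z + \<gamma> y (D z)"
  shows "D (curv \<gamma> y z w) = curv \<gamma> (D y) z w + curv \<gamma> y (D z) w + curv \<gamma> y z (D w)"
proof -
  have "D (br y z) = br (D y) z + br y (D z)"
    by (simp add: linear_diff[OF D] der flip: torsion_free)
  then show ?thesis
    by (simp add: curv_def linear_diff[OF D] der bilinear_ladd[OF \<gamma>] bilinear_radd[OF \<gamma>])
qed

end

lemma pseudo_riemannian_left_metric:
  assumes B: "bilinear B" and sym: "\<And>x y. B x y = B y x"
    and nondeg: "\<And>x. (\<And>y. B x y = 0) \<Longrightarrow> x = 0"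
  shows "pseudo_riemannian_metric A (left_metric \<iota> B)"
  unfolding pseudo_riemannian_metric_def
proof (intro conjI ballI allI impI)
  fix X Y Z
  assume X: "X \<in> vector_fields A" and Y: "Y \<in> vector_fields A"
  show "left_metric \<iota> B X Y \<in> smooth_funs A"
    using smooth_valuedD[OF smooth_valued_bilinear[OF man fin B smooth_valued_left_triv[OF X]
        smooth_valued_left_triv[OF Y]] linear_id]
    by (simp add: left_metric_def)
  show "left_metric \<iota> B X Y = left_metric \<iota> B Y X"
    by (simp add: left_metric_def sym)
  assume Z: "Z \<in> vector_fields A"
  show "left_metric \<iota> B (X + Y) Z = left_metric \<iota> B X Z + left_metric \<iota> B Y Z"
    using X Y Z by (intro ext) (simp add: left_metric_def left_triv_simps bilinear_ladd[OF B])
next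
  fix f X Y
  assume "f \<in> smooth_funs A" "X \<in> vector_fields A" "Y \<in> vector_fields A"
  then show "left_metric \<iota> B (fmul f X) Y = f * left_metric \<iota> B X Y"
    by (simp add: left_metric_def left_triv_simps bilinear_lmul[OF B] times_fun_def)
next
  fix p X
  assume X: "X \<in> vector_fields A" and H: "\<forall>Y\<in>vector_fields A. left_metric \<iota> B X Y p = 0"
  have "B (triv X p) y = 0" for y
    using H[rule_format, OF frame_vf[of y]] by (simp add: left_metric_def left_triv_frame)
  then have "triv X p = 0" by (rule nondeg)
  then show "vf_at X p = 0"
    using frame_left_triv[OF X, of p] linear_0[OF linear_frame]
    by (simp add: vf_at_def fun_eq_iff)
qed

text \<open>The operators \<open>D x\<close> are the values on frame fields of the connection \<open>\<nabla> - T\<close>. If they are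
derivations of \<open>\<gamma>\<close> and of \<open>t\<close>, they are derivations of the curvature, too. The conditions on the
covariant derivatives of \<open>T\<close> and of the curvature express that both are parallel for \<open>\<nabla> - T\<close>, and
since both have constant coefficients this is the derivation property.\<close>

theorem naturally_reductive_left_tensor:
  assumes conn: "connected (UNIV :: 'g set)" "simply_connected (UNIV :: 'g set)"
    and B: "bilinear B" and sym: "\<And>x y. B x y = B y x"
    and nondeg: "\<And>x. (\<And>y. B x y = 0) \<Longrightarrow> x = 0"
    and \<gamma>: "bilinear \<gamma>"
    and torsion_free: "\<And>x y. \<gamma> x y - \<gamma> y x = br x y"
    and metric: "\<And>x y z. B (\<gamma> x y) z + B y (\<gamma> x z) = 0"
    and t: "bilinear t"
    and t_skew: "\<And>x y z. B (t x y) z + B y (t x z) = 0"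
    and t_alt: "\<And>x. t x x = 0"
    and D: "\<And>x y. D x y = \<gamma> x y - t x y"
    and D_\<gamma>: "\<And>x y z. D x (\<gamma> y z) = \<gamma> (D x y) z + \<gamma> y (D x z)"
    and D_t: "\<And>x y z. D x (t y z) = t (D x y) z + t y (D x z)"
  shows "naturally_reductive_structure A (left_metric \<iota> B) (left_tensor \<iota> t)"
  unfolding naturally_reductive_structure_def
proof (intro conjI exI[of _ "connection \<gamma>"] ballI)
  note bil = bilinear_ladd[OF t] bilinear_radd[OF t] bilinear_lsub[OF t] bilinear_rsub[OF t]
    curv_add[OF \<gamma>] curv_diff[OF \<gamma>]
  show "smooth_manifold A" by (rule man)
  show "pseudo_riemannian_metric A (left_metric \<iota> B)"
    by (rule pseudo_riemannian_left_metric[OF B sym nondeg])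
  show "tensor_field_12 A (left_tensor \<iota> t)" by (rule tensor_field_left_tensor[OF t])
  show "levi_civita A (left_metric \<iota> B) (connection \<gamma>)"
  proof (rule levi_civita_connection[OF \<gamma> B])
    show "\<gamma> x y - \<gamma> y x = br x y" for x y by (rule torsion_free)
    show "B (\<gamma> x y) z + B y (\<gamma> x z) = 0" for x y z by (rule metric)
  qed
  have linear_D: "linear (D x)" for x
    using \<gamma> t unfolding D by (auto simp: bilinear_def intro: linear_compose_sub)
  fix X assume X: "X \<in> vector_fields A"
  show "left_tensor \<iota> t X X = 0"
    by (intro ext) (simp add: left_tensor_def t_alt linear_0[OF linear_frame])
  fix Y W assume Y: "Y \<in> vector_fields A" and W: "W \<in> vector_fields A"
  show "left_metric \<iota> B (left_tensor \<iota> t X Y) W + left_metric \<iota> B Y (left_tensor \<iota> t X W) = 0"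
    by (intro ext) (simp add: left_metric_def left_tensor_eq_field_of left_triv_field_of t_skew)
  have "t (triv X p) (t (triv Y p) (triv W p)) + D (triv X p) (t (triv Y p) (triv W p)) =
      \<gamma> (triv X p) (t (triv Y p) (triv W p))" for p
    by (simp add: D)
  then show "cov_deriv_tensor (connection \<gamma>) (left_tensor \<iota> t) X Y W =
      left_tensor \<iota> t X (left_tensor \<iota> t Y W) - left_tensor \<iota> t Y (left_tensor \<iota> t X W)
        - left_tensor \<iota> t (left_tensor \<iota> t X Y) W"
    using X Y W D_t[of "triv X _" "triv Y _" "triv W _"]
    unfolding cov_deriv_tensor_def connection_def left_tensor_eq_field_of left_triv_field_of
      field_of_diff[symmetric]
    by (intro arg_cong[of _ _ field_of] ext)
      (simp add: dir_deriv_bilinear[OF man fin _ _ _ t] smooth_valued_left_triv bil D algebra_simps)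
  fix Z assume Z: "Z \<in> vector_fields A"
  have curv: "curvature (connection \<gamma>) P Q R = field_of (\<lambda>p. curv \<gamma> (triv P p) (triv Q p) (triv R p))"
    if "P \<in> vector_fields A" "Q \<in> vector_fields A" "R \<in> vector_fields A" for P Q R
    using that by (rule curvature_connection[OF \<gamma>])
  have "D (triv X p) (curv \<gamma> (triv Y p) (triv Z p) (triv W p)) =
      curv \<gamma> (D (triv X p) (triv Y p)) (triv Z p) (triv W p)
      + curv \<gamma> (triv Y p) (D (triv X p) (triv Z p)) (triv W p)
      + curv \<gamma> (triv Y p) (triv Z p) (D (triv X p) (triv W p))" for p
  proof (rule derivation_curv[OF \<gamma> linear_D])
    show "\<gamma> x y - \<gamma> y x = br x y" for x y by (rule torsion_free)
    show "D (triv X p) (\<gamma> y z) = \<gamma> (D (triv X p) y) z + \<gamma> y (D (triv X p) z)" for y z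
      by (rule D_\<gamma>)
  qed
  then show "cov_deriv_curvature (connection \<gamma>) X Y Z W =
      left_tensor \<iota> t X (curvature (connection \<gamma>) Y Z W)
        - curvature (connection \<gamma>) Y Z (left_tensor \<iota> t X W)
        - curvature (connection \<gamma>) (left_tensor \<iota> t X Y) Z W
        - curvature (connection \<gamma>) Y (left_tensor \<iota> t X Z) W"
    using X Y Z W
    apply (simp add: cov_deriv_curvature_def curv connection_vf[OF \<gamma>] left_tensor_vf[OF t])
    unfolding connection_def left_tensor_eq_field_of left_triv_field_of field_of_diff[symmetric]
    by (intro arg_cong[of _ _ field_of] ext)
      (simp add: dir_deriv_curv[OF \<gamma>] smooth_valued_left_triv bil D algebra_simps)
qed (use conn in auto)

end

section \<open>Left-invariant frames on Lie groups\<close>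

text \<open>In charts \<open>\<psi>\<close> around \<open>a\<close> and \<open>\<phi>\<close> around \<open>p\<close>, the translated function is the slice at \<open>\<psi> a\<close> of a
coordinate expression of \<open>f\<close> composed with the multiplication.\<close>

lemma smooth_funs_left_translation:
  assumes G: "lie_group A mul e iv" and f: "f \<in> smooth_funs A"
  shows "f \<circ> mul a \<in> smooth_funs A"
proof -
  define m where "m = (\<lambda>(a, b). mul a b)"
  have man: "smooth_manifold A" and smooth: "smooth_map (prod_atlas A A) A m"
    using G by (auto simp: lie_group_def m_def)
  have fin: "fin_dim TYPE('b)"
    using man by (simp add: smooth_manifold_def)
  have cover: "\<exists>U \<phi>. (U, \<phi>) \<in> A \<and> x \<in> U" for x
  proof -
    have "x \<in> (\<Union>(U, \<phi>)\<in>A. U)" using man by (simp add: smooth_manifold_def)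
    then show ?thesis by auto
  qed
  have near: "smooth_near (\<phi> p) ((f \<circ> mul a) \<circ> inv_into U \<phi>)" if U: "(U, \<phi>) \<in> A" and p: "p \<in> U" for U \<phi> p
  proof -
    obtain V \<psi> where V: "(V, \<psi>) \<in> A" "a \<in> V" using cover by blast
    obtain W \<kappa> where W: "(W, \<kappa>) \<in> A" "mul a p \<in> W" using cover by blast
    define i where "i = inv_into (V \<times> U) (map_prod \<psi> \<phi>)"
    define S where "S = map_prod \<psi> \<phi> ` (V \<times> U \<inter> m -` W)"
    have "(V \<times> U, map_prod \<psi> \<phi>) \<in> prod_atlas A A"
      using U V by (auto simp: prod_atlas_def)
    then have G: "smooth_on S (\<kappa> \<circ> m \<circ> i)"
      using smooth W(1) unfolding smooth_map_def S_def i_def by blast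
    have inj: "inj_on (map_prod \<psi> \<phi>) (V \<times> U)"
      using chart_facts(3)[OF man U] chart_facts(3)[OF man V(1)] by (rule map_prod_inj_on[rotated])
    have i: "i (\<psi> v, \<phi> u) = (v, u)" if "v \<in> V" "u \<in> U" for u v
      unfolding i_def using inv_into_f_f[OF inj, of "(v, u)"] that by simp
    have "open S"
    proof -
      have c: "continuous_on (\<psi> ` V) (inv_into V \<psi>)" "continuous_on (\<phi> ` U) (inv_into U \<phi>)"
        using chart_facts(4)[OF man U] chart_facts(4)[OF man V(1)] by (auto simp: homeomorphism_def)
      have "continuous_on (\<psi> ` V \<times> \<phi> ` U) (\<lambda>z. inv_into V \<psi> (fst z))"
        by (rule continuous_on_compose2[OF c(1) continuous_on_fst[OF continuous_on_id]])
          (simp add: image_subset_iff mem_Times_iff)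
      moreover have "continuous_on (\<psi> ` V \<times> \<phi> ` U) (\<lambda>z. inv_into U \<phi> (snd z))"
        by (rule continuous_on_compose2[OF c(2) continuous_on_snd[OF continuous_on_id]])
          (simp add: image_subset_iff mem_Times_iff)
      ultimately have "continuous_on (\<psi> ` V \<times> \<phi> ` U) (\<lambda>z. (inv_into V \<psi> (fst z), inv_into U \<phi> (snd z)))"
        by (rule continuous_on_Pair)
      then have "continuous_on (\<psi> ` V \<times> \<phi> ` U) (\<lambda>z. m (inv_into V \<psi> (fst z), inv_into U \<phi> (snd z)))"
        using smooth continuous_on_compose2[of UNIV m] by (simp add: smooth_map_def)
      then have "open ((\<psi> ` V \<times> \<phi> ` U) \<inter>
          (\<lambda>z. m (inv_into V \<psi> (fst z), inv_into U \<phi> (snd z))) -` W)"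
        by (intro continuous_open_preimage open_Times chart_facts(2)[OF man U]
            chart_facts(2)[OF man V(1)] chart_facts(1)[OF man W(1)])
      also have "\<dots> = S"
        using chart_facts(3)[OF man U] chart_facts(3)[OF man V(1)]
        by (force simp: S_def)
      finally show ?thesis .
    qed
    define F where "F = (\<lambda>z. (f \<circ> inv_into W \<kappa>) ((\<kappa> \<circ> m \<circ> i) z))"
    have "(\<kappa> \<circ> m \<circ> i) ` S \<subseteq> \<kappa> ` W"
      by (auto simp: S_def i)
    moreover have "smooth_on (\<kappa> ` W) (f \<circ> inv_into W \<kappa>)"
      using f W(1) by (auto simp: smooth_funs_def)
    ultimately have "smooth_on S F"
      using G C_k_on_compose[OF fin \<open>open S\<close>] unfolding smooth_on_def F_def by blast
    then have slice: "smooth_on {x. (\<psi> a, x) \<in> S} (\<lambda>x. F (\<psi> a, x))"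
      using C_k_on_slice[OF \<open>open S\<close>] by (auto simp: smooth_on_def)
    have op: "open {x. (\<psi> a, x) \<in> S}"
      using open_vimage[OF \<open>open S\<close>, of "Pair (\<psi> a)"] by (simp add: vimage_def continuous_on_Pair)
    have "F (\<psi> a, x) = ((f \<circ> mul a) \<circ> inv_into U \<phi>) x" if x: "(\<psi> a, x) \<in> S" for x
    proof -
      obtain v u where vu: "v \<in> V" "u \<in> U" "\<psi> a = \<psi> v" "x = \<phi> u" "mul v u \<in> W"
        using x by (auto simp: S_def m_def)
      then have "v = a" using chart_facts(3)[OF man V(1)] V(2) by (auto dest: inj_onD)
      then show ?thesis
        using vu chart_facts(3)[OF man W(1)] chart_facts(3)[OF man U] by (simp add: F_def i m_def)
    qed
    then have "smooth_on {x. (\<psi> a, x) \<in> S} ((f \<circ> mul a) \<circ> inv_into U \<phi>)"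
      by (intro smooth_on_cong[OF op _ slice]) auto
    moreover have "(\<psi> a, \<phi> p) \<in> S"
      using V(2) W(2) p by (force simp: S_def m_def)
    ultimately show ?thesis
      using op by (intro smooth_nearI) auto
  qed
  then show ?thesis
    unfolding smooth_funs_iff_smooth_near[OF man] by blast
qed

text \<open>Simple connectedness is a statement about free homotopies of loops, so two constant loops are
homotopic, and a homotopy between them traces a path.\<close>

lemma connected_if_simply_connected:
  fixes S :: "'a::topological_space set"
  assumes "simply_connected S"
  shows "connected S"
proof (rule path_connected_imp_connected)
  have "path_component S p q" if "p \<in> S" "q \<in> S" for p q
  proof -
    have "homotopic_loops S (\<lambda>_. p) (\<lambda>_. q)"
      using assms[unfolded simply_connected_def, rule_format, of "\<lambda>_. p" "\<lambda>_. q"] that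
      by (auto simp: path_def pathstart_def pathfinish_def path_image_def)
    from homotopic_loops_imp_path_component_value[OF this, of 0] show ?thesis by simp
  qed
  then show "path_connected S"
    by (simp add: path_connected_component)
qed

text \<open>Left translation by \<open>p\<close> identifies the tangent space at \<open>e\<close> with that at \<open>p\<close> and maps the value at
\<open>e\<close> of a left-invariant field to its value at \<open>p\<close>.\<close>

lemma lie_group_frame:
  fixes A :: "('g::{t2_space, second_countable_topology}, 'e::real_inner) chart set"
    and \<iota> :: "'a::real_vector \<Rightarrow> 'g vfield"
  assumes G: "lie_group A mul e iv" and fin: "fin_dim TYPE('a)" and br: "bilinear br"
    and \<iota>: "is_lie_algebra_of A mul e br \<iota>"
  shows "lie_frame A \<iota> br"
proof
  show man: "smooth_manifold A" using G by (simp add: lie_group_def)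
  show "fin_dim TYPE('a)" "bilinear br" by (rule fin br)+
  show vf: "\<iota> x \<in> vector_fields A" for x
    using \<iota> by (auto simp: is_lie_algebra_of_def left_invariant_fields_def)
  show "\<iota> (x + y) = \<iota> x + \<iota> y" "\<iota> (c *\<^sub>R x) = fmul (\<lambda>_. c) (\<iota> x)"
    "\<iota> (br x y) = vf_bracket (\<iota> x) (\<iota> y)" for c x y
    using \<iota> by (auto simp: is_lie_algebra_of_def)
  interpret grp: group mul e iv using G by (simp add: lie_group_def)
  have inv: "\<iota> x (f \<circ> mul a) p = \<iota> x f (mul a p)" if "f \<in> smooth_funs A" for x f a p
    using \<iota> that by (auto simp: is_lie_algebra_of_def left_invariant_fields_def)
  have bij: "bij_betw (\<lambda>x. vf_at (\<iota> x) e) UNIV (tangent_space A e)"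
    using \<iota> by (simp add: is_lie_algebra_of_def)
  show "bij_betw (\<lambda>x. vf_at (\<iota> x) p) UNIV (tangent_space A p)" for p
    unfolding bij_betw_def
  proof
    show "inj (\<lambda>x. vf_at (\<iota> x) p)"
    proof (rule injI)
      fix x y assume H: "vf_at (\<iota> x) p = vf_at (\<iota> y) p"
      have "\<iota> x f e = \<iota> y f e" for f
      proof (cases "f \<in> smooth_funs A")
        case True
        then show ?thesis
          using inv[OF True, of _ "iv p" p] fun_cong[OF H, of "f \<circ> mul (iv p)"]
          by (simp add: vf_at_def)
      qed (simp add: vf_nonsmooth[OF man vf])
      then show "x = y"
        using injD[OF bij_betw_imp_inj_on[OF bij]] by (simp add: vf_at_def)
    qed
    show "range (\<lambda>x. vf_at (\<iota> x) p) = tangent_space A p"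
    proof
      show "range (\<lambda>x. vf_at (\<iota> x) p) \<subseteq> tangent_space A p"
        using vf_tangent[OF man vf] by auto
      show "tangent_space A p \<subseteq> range (\<lambda>x. vf_at (\<iota> x) p)"
      proof
        fix v assume v: "v \<in> tangent_space A p"
        \<comment> \<open>the translate of \<open>v\<close> to the identity\<close>
        define w where "w = (\<lambda>f. if f \<in> smooth_funs A then v (f \<circ> mul (iv p)) else 0)"
        note tr = smooth_funs_left_translation[OF G]
        have comp: "(f + g) \<circ> mul (iv p) = (f \<circ> mul (iv p)) + (g \<circ> mul (iv p))"
          "(f * g) \<circ> mul (iv p) = (f \<circ> mul (iv p)) * (g \<circ> mul (iv p))"
          "(\<lambda>q. c * f q) \<circ> mul (iv p) = (\<lambda>q. c * (f \<circ> mul (iv p)) q)" for f g :: "'g \<Rightarrow> real" and c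
          by (auto simp: comp_def)
        have "w \<in> tangent_space A e"
          unfolding tangent_space_def
        proof (intro CollectI conjI ballI allI impI)
          fix f g assume f: "f \<in> smooth_funs A" and g: "g \<in> smooth_funs A"
          have "f + g \<in> smooth_funs A" "f * g \<in> smooth_funs A"
            using smooth_funs_add[OF man f g] smooth_funs_mult[OF man f g]
            by (simp_all add: plus_fun_def times_fun_def)
          then show "w (f + g) = w f + w g" "w (f * g) = w f * g e + f e * w g"
            using v f g tr[OF f, of "iv p"] tr[OF g, of "iv p"]
            by (auto simp: w_def comp tangent_space_def)
        next
          fix c f assume f: "f \<in> smooth_funs A"
          show "w (\<lambda>q. c * f q) = c * w f"
            using v f tr[OF f, of "iv p"] smooth_funs_mult[OF man smooth_funs_const f]
            by (auto simp: w_def comp tangent_space_def simp del: comp_apply)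
        qed (simp add: w_def)
        then obtain x where x: "w = vf_at (\<iota> x) e"
          using bij_betw_imp_surj_on[OF bij] by blast
        have "v f = \<iota> x f p" for f
        proof (cases "f \<in> smooth_funs A")
          case True
          have "(f \<circ> mul p) \<circ> mul (iv p) = f"
            by (simp add: comp_def flip: grp.assoc)
          then have "v f = w (f \<circ> mul p)"
            using tr[OF True] by (simp add: w_def)
          then show ?thesis
            using inv[OF True, of x p e] by (simp add: x vf_at_def)
        next
          case False
          then show ?thesis
            using v by (simp add: vf_nonsmooth[OF man vf] tangent_space_def)
        qed
        then have "v = vf_at (\<iota> x) p" by (auto simp: vf_at_def)
        then show "v \<in> range (\<lambda>x. vf_at (\<iota> x) p)" by blast
      qed
    qed
  qed
qed

section \<open>The dual of a Lie algebra with invariant metric\<close>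

context
  fixes hbr :: "'h::real_vector \<Rightarrow> 'h \<Rightarrow> 'h" and hB :: "'h \<Rightarrow> 'h \<Rightarrow> real"
  assumes lie: "lie_algebra hbr" and metric: "ad_invariant_metric hbr hB"
begin

private lemma hB: "bilinear hB"
  using metric by (simp add: ad_invariant_metric_def)

lemma dual_app_flat: "dual_app (flat hB h) k = hB h k"
  using hB by (simp add: flat_def bilinear_def dual_app_Abs_dual)

lemma linear_flat: "linear (flat hB)"
  by (intro linearI lin_dual_eqI)
    (simp_all add: dual_app_flat dual_app_simps bilinear_ladd[OF hB] bilinear_lmul[OF hB])

text \<open>Injectivity is nondegeneracy. A functional is determined by its values on a finite basis, so
surjectivity follows by counting dimensions in \<open>\<hh>\<close> alone, for the endomorphism \<open>\<Phi>\<close> that lists the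
values of \<open>h\<^sup>*\<close> on the basis.\<close>

lemma bij_flat: "bij (flat hB)"
proof (rule bijI)
  show "inj (flat hB)"
    unfolding linear_injective_0[OF linear_flat]
  proof (intro allI impI)
    fix h assume "flat hB h = 0"
    then have "hB h k = 0" for k by (simp flip: dual_app_flat add: dual_app_simps)
    then show "h = 0" using metric by (simp add: ad_invariant_metric_def)
  qed
  have fin: "fin_dim TYPE('h)" using lie by (simp add: lie_algebra_def)
  interpret fd: finite_dimensional_vector_space "(*\<^sub>R) :: real \<Rightarrow> 'h \<Rightarrow> 'h" fin_basis
    using fin_basis[OF fin]
    by unfold_locales (simp_all add: algebra_simps flip: dependent_raw_def span_raw_def)
  define \<Phi> where "\<Phi> h = (\<Sum>b\<in>fin_basis. hB h b *\<^sub>R b)" for h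
  have "linear \<Phi>"
    unfolding \<Phi>_def
    by (rule linearI) (simp_all add: bilinear_ladd[OF hB] bilinear_lmul[OF hB]
        scaleR_left_distrib sum.distrib scaleR_sum_right)
  have on_basis: "flat hB h = \<alpha>" if "\<And>b. b \<in> fin_basis \<Longrightarrow> hB h b = dual_app \<alpha> b" for h \<alpha>
  proof (rule lin_dual_eqI)
    fix k
    have "linear (hB h)" using hB by (simp add: bilinear_def)
    from linear_expansion[OF fin this, of k]
    have "hB h k = (\<Sum>b\<in>fin_basis. coord b k *\<^sub>R dual_app \<alpha> b)"
      using that by simp
    also have "\<dots> = dual_app \<alpha> k"
      by (rule linear_expansion[OF fin linear_dual_app, symmetric])
    finally show "dual_app (flat hB h) k = dual_app \<alpha> k"
      by (simp add: dual_app_flat)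
  qed
  have "inj \<Phi>"
    unfolding linear_injective_0[OF \<open>linear \<Phi>\<close>]
  proof (intro allI impI)
    fix h assume "\<Phi> h = 0"
    then have "hB h b = 0" if "b \<in> fin_basis" for b
      using coord_coefficients[OF fin that, of "hB h"] linear_0[OF linear_coord[OF fin]]
      by (simp add: \<Phi>_def)
    then have "flat hB h = 0"
      by (intro on_basis) (simp add: dual_app_simps)
    then show "h = 0"
      using \<open>inj (flat hB)\<close> linear_0[OF linear_flat] by (metis injD)
  qed
  then have "surj \<Phi>"
    using fd.linear_inj_imp_surj \<open>linear \<Phi>\<close> by (simp add: linear_def)
  show "surj (flat hB)"
  proof (rule surjI)
    fix \<alpha> :: "'h lin_dual"
    define h where "h = inv \<Phi> (\<Sum>b\<in>fin_basis. dual_app \<alpha> b *\<^sub>R b)"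
    have "\<Phi> h = (\<Sum>b\<in>fin_basis. dual_app \<alpha> b *\<^sub>R b)"
      unfolding h_def using \<open>surj \<Phi>\<close> by (rule surj_f_inv_f)
    then show "flat hB (inv \<Phi> (\<Sum>b\<in>fin_basis. dual_app \<alpha> b *\<^sub>R b)) = \<alpha>"
      using coord_coefficients[OF fin] unfolding \<Phi>_def h_def[symmetric]
      by (intro on_basis) metis
  qed
qed

lemma sharp_flat: "sharp hB (flat hB h) = h"
  unfolding sharp_def using bij_flat by (simp add: bij_def)

lemma flat_sharp: "flat hB (sharp hB \<alpha>) = \<alpha>"
  unfolding sharp_def using bij_flat by (simp add: bij_def surj_f_inv_f)

lemma linear_sharp: "linear (sharp hB)"
proof (rule linearI)
  fix \<alpha> \<gamma> :: "'h lin_dual" and c :: real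
  have "sharp hB (flat hB (sharp hB \<alpha> + sharp hB \<gamma>)) = sharp hB \<alpha> + sharp hB \<gamma>"
    by (rule sharp_flat)
  then show "sharp hB (\<alpha> + \<gamma>) = sharp hB \<alpha> + sharp hB \<gamma>"
    by (simp add: linear_add[OF linear_flat] flat_sharp)
  have "sharp hB (flat hB (c *\<^sub>R sharp hB \<alpha>)) = c *\<^sub>R sharp hB \<alpha>"
    by (rule sharp_flat)
  then show "sharp hB (c *\<^sub>R \<alpha>) = c *\<^sub>R sharp hB \<alpha>"
    by (simp add: linear_scale[OF linear_flat] flat_sharp)
qed

lemma metric_sharp: "hB (sharp hB \<alpha>) h = dual_app \<alpha> h"
  by (metis dual_app_flat flat_sharp)

lemma dual_app_coad: "dual_app (coad hbr h \<alpha>) k = - dual_app \<alpha> (hbr h k)"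
proof -
  have "linear (hbr h)" using lie by (simp add: lie_algebra_def bilinear_def)
  from linear_compose_neg[OF linear_compose[OF this linear_dual_app[of \<alpha>]]]
  show ?thesis by (simp add: coad_def comp_def dual_app_Abs_dual)
qed

text \<open>By invariance of the metric, \<open>h \<mapsto> h\<^sup>*\<close> intertwines the adjoint and the coadjoint representation.\<close>

lemma coad_flat: "coad hbr h (flat hB k) = flat hB (hbr h k)"
proof (rule lin_dual_eqI)
  fix z
  have "hB (hbr h k) z = - hB k (hbr h z)"
    using metric unfolding ad_invariant_metric_def by blast
  then show "dual_app (coad hbr h (flat hB k)) z = dual_app (flat hB (hbr h k)) z"
    by (simp add: dual_app_coad dual_app_flat)
qed

lemma fin_dim_prod_dual:
  assumes "fin_dim TYPE('d::real_vector)"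
  shows "fin_dim TYPE('d \<times> 'h lin_dual)"
proof -
  obtain B :: "'h set" and C :: "'d set"
    where B: "finite B" "span B = UNIV" and C: "finite C" "span C = UNIV"
    using lie assms by (auto simp: lie_algebra_def fin_dim_def)
  define S where "S = (\<lambda>c. (c, 0)) ` C \<union> (\<lambda>b. (0, flat hB b)) ` B"
  have lin: "linear (\<lambda>c::'d. (c, 0::'h lin_dual))" "linear (\<lambda>b. (0::'d, flat hB b))"
    by (auto intro!: linearI simp: linear_add[OF linear_flat] linear_scale[OF linear_flat])
  have "(x, \<alpha>) \<in> span S" for x \<alpha>
  proof -
    have "(x, 0 :: 'h lin_dual) \<in> span ((\<lambda>c. (c, 0)) ` C)"
      unfolding linear_span_image[OF lin(1)] C by simp
    moreover have "(0 :: 'd, flat hB (sharp hB \<alpha>)) \<in> span ((\<lambda>b. (0, flat hB b)) ` B)"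
      unfolding linear_span_image[OF lin(2)] B by simp
    ultimately have "(x, 0) + (0, \<alpha>) \<in> span S"
      unfolding S_def flat_sharp
      using span_mono[OF Un_upper1] span_mono[OF Un_upper2] by (intro span_add) blast+
    then show ?thesis by simp
  qed
  then have "span S = UNIV" by auto
  moreover have "finite S" using B C by (simp add: S_def)
  ultimately show ?thesis by (auto simp: fin_dim_def)
qed

end

section \<open>The naturally reductive structure on \<open>\<G>(\<dd>)\<close>\<close>

locale double_extension_data =
  fixes hbr :: "'h::real_vector \<Rightarrow> 'h \<Rightarrow> 'h" and hB :: "'h \<Rightarrow> 'h \<Rightarrow> real"
    and dbr :: "'d::real_vector \<Rightarrow> 'd \<Rightarrow> 'd" and dB :: "'d \<Rightarrow> 'd \<Rightarrow> real"
    and \<pi> :: "'h \<Rightarrow> 'd \<Rightarrow> 'd"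
  assumes h_lie: "lie_algebra hbr" and h_metric: "ad_invariant_metric hbr hB"
    and d_lie: "lie_algebra dbr" and d_metric: "ad_invariant_metric dbr dB"
    and hom: "lie_hom_Dera hbr dbr dB \<pi>"
begin

lemmas sharp_flat' [simp] = sharp_flat[OF h_lie h_metric]
lemmas flat_sharp' [simp] = flat_sharp[OF h_lie h_metric]

lemma bil: "bilinear hbr" "bilinear hB" "bilinear dbr" "bilinear dB"
  using h_lie h_metric d_lie d_metric by (auto simp: lie_algebra_def ad_invariant_metric_def)

lemma \<pi>_linear: "linear (\<pi> h)" "linear (\<lambda>h. \<pi> h x)"
  using hom by (auto simp: lie_hom_Dera_def Dera_def)

lemmas lin = bil[THEN bilinear_ladd] bil[THEN bilinear_radd] bil[THEN bilinear_lsub]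
  bil[THEN bilinear_rsub] bil[THEN bilinear_lneg] bil[THEN bilinear_rneg]
  bil[THEN bilinear_lmul] bil[THEN bilinear_rmul] bil[THEN bilinear_lzero] bil[THEN bilinear_rzero]
  \<pi>_linear[THEN linear_add] \<pi>_linear[THEN linear_diff] \<pi>_linear[THEN linear_neg]
  \<pi>_linear[THEN linear_scale] \<pi>_linear[THEN linear_0]

lemmas sharp_lin = linear_sharp[OF h_lie h_metric, THEN linear_add]
  linear_sharp[OF h_lie h_metric, THEN linear_diff] linear_sharp[OF h_lie h_metric, THEN linear_neg]
  linear_sharp[OF h_lie h_metric, THEN linear_scale] linear_sharp[OF h_lie h_metric, THEN linear_0]

lemmas flat_lin = linear_flat[OF h_lie h_metric, THEN linear_add]
  linear_flat[OF h_lie h_metric, THEN linear_diff] linear_flat[OF h_lie h_metric, THEN linear_neg]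
  linear_flat[OF h_lie h_metric, THEN linear_scale] linear_flat[OF h_lie h_metric, THEN linear_0]

lemma hbr_antisym: "hbr y x = - hbr x y"
proof -
  have "hbr (x + y) (x + y) = 0" "hbr x x = 0" "hbr y y = 0"
    using h_lie by (auto simp: lie_algebra_def)
  then show ?thesis by (simp add: lin eq_neg_iff_add_eq_0)
qed

lemma dbr_antisym: "dbr y x = - dbr x y"
proof -
  have "dbr (x + y) (x + y) = 0" "dbr x x = 0" "dbr y y = 0"
    using d_lie by (auto simp: lie_algebra_def)
  then show ?thesis by (simp add: lin eq_neg_iff_add_eq_0)
qed

lemma hbr_leibniz: "hbr x (hbr y z) = hbr (hbr x y) z + hbr y (hbr x z)"
proof -
  have "hbr x (hbr y z) + hbr y (hbr z x) + hbr z (hbr x y) = 0"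
    using h_lie by (auto simp: lie_algebra_def)
  moreover have "hbr y (hbr z x) = - hbr y (hbr x z)" "hbr z (hbr x y) = - hbr (hbr x y) z"
    using hbr_antisym[of z x] hbr_antisym[of z "hbr x y"] by (simp_all add: lin)
  ultimately show ?thesis by (simp add: algebra_simps add_eq_0_iff)
qed

lemma hB_inv: "hB (hbr x y) z = - hB y (hbr x z)" and hB_sym: "hB x y = hB y x"
  using h_metric unfolding ad_invariant_metric_def by blast+

lemma dB_inv: "dB (dbr x y) z = - dB y (dbr x z)" and dB_sym: "dB x y = dB y x"
  using d_metric unfolding ad_invariant_metric_def by blast+

lemma \<pi>_der: "\<pi> h (dbr x y) = dbr (\<pi> h x) y + dbr x (\<pi> h y)"
  and \<pi>_skew: "dB (\<pi> h x) y = - dB x (\<pi> h y)"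
  and \<pi>_hom: "\<pi> (hbr h k) x = \<pi> h (\<pi> k x) - \<pi> k (\<pi> h x)"
  using hom by (auto simp: lie_hom_Dera_def Dera_def)

lemma dual_app_beta: "dual_app (beta dB \<pi> x y) h = dB (\<pi> h x) y"
proof -
  have "linear (\<lambda>h. dB (\<pi> h x) y)" by (rule linearI) (simp_all add: lin)
  then show ?thesis by (simp add: beta_def dual_app_Abs_dual)
qed

lemma bilinear_beta: "bilinear (beta dB \<pi>)"
  unfolding bilinear_def
  by (intro conjI allI linearI lin_dual_eqI) (simp_all add: dual_app_beta dual_app_simps lin)

lemmas beta_lin = bilinear_ladd[OF bilinear_beta] bilinear_radd[OF bilinear_beta]
  bilinear_lsub[OF bilinear_beta] bilinear_rsub[OF bilinear_beta] bilinear_lneg[OF bilinear_beta]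
  bilinear_rneg[OF bilinear_beta] bilinear_lmul[OF bilinear_beta] bilinear_rmul[OF bilinear_beta]

lemma beta_antisym: "beta dB \<pi> y x = - beta dB \<pi> x y"
  by (intro lin_dual_eqI) (simp add: dual_app_beta dual_app_simps \<pi>_skew[of _ y] dB_sym[of y])

text \<open>Applied to \<open>k\<close>, the left-hand side is \<open>-\<beta>(x, y)([h, k])\<close>. The homomorphism property of \<open>\<pi>\<close> turns
\<open>\<pi>([h, k])\<close> into a commutator, and skewness of \<open>\<pi>(h)\<close> moves one factor to \<open>y\<close>.\<close>

lemma beta_equivariant:
  "flat hB (hbr h (sharp hB (beta dB \<pi> x y))) = beta dB \<pi> (\<pi> h x) y + beta dB \<pi> x (\<pi> h y)"
proof (rule lin_dual_eqI)
  fix k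
  have "dual_app (flat hB (hbr h (sharp hB (beta dB \<pi> x y)))) k = - dB (\<pi> (hbr h k) x) y"
    by (simp add: dual_app_flat[OF h_lie h_metric] hB_inv metric_sharp[OF h_lie h_metric] dual_app_beta)
  then show "dual_app (flat hB (hbr h (sharp hB (beta dB \<pi> x y)))) k =
      dual_app (beta dB \<pi> (\<pi> h x) y + beta dB \<pi> x (\<pi> h y)) k"
    by (simp add: dual_app_simps dual_app_beta \<pi>_hom lin \<pi>_skew[of h])
qed

lemma Gd_metric_eq: "Gd_metric hB dB (x, \<alpha>) (y, \<gamma>) = dual_app \<alpha> (sharp hB \<gamma>) + dB x y"
  by (simp add: metric_sharp[OF h_lie h_metric])

lemma bilinear_Gd_metric: "bilinear (Gd_metric hB dB)"
  unfolding bilinear_def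
  by (intro conjI allI linearI; clarify?)
    (auto simp: split_paired_all lin sharp_lin algebra_simps)

lemma bilinear_Gd_bracket: "bilinear (Gd_bracket dbr dB \<pi>)"
  unfolding bilinear_def
  by (intro conjI allI linearI; clarify?) (auto simp: split_paired_all lin beta_lin)

text \<open>The complement \<open>\<hh>\<close> consists of the triples whose last two entries vanish, so the \<open>\<mm>\<close>-component
keeps these entries and is determined by them.\<close>

lemma m_part_eq: "m_part hB (k, x, \<alpha>) = (sharp hB \<alpha>, x, \<alpha>)"
  unfolding m_part_def
proof (rule the_equality)
  show "(sharp hB \<alpha>, x, \<alpha>) \<in> m_sub hB \<and> (k, x, \<alpha>) - (sharp hB \<alpha>, x, \<alpha>) \<in> h_sub"
    by (auto simp: m_sub_def h_sub_def zero_prod_def)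
  show "w = (sharp hB \<alpha>, x, \<alpha>)" if "w \<in> m_sub hB \<and> (k, x, \<alpha>) - w \<in> h_sub" for w
    using that by (auto simp: m_sub_def h_sub_def)
qed

lemma inv_lam: "inv (lam hB) (sharp hB \<alpha>, x, \<alpha>) = (x, \<alpha>)"
proof -
  have "inj (lam hB)" by (auto simp: inj_def lam_def)
  then show ?thesis using inv_f_f[of "lam hB" "(x, \<alpha>)"] by (simp add: lam_def)
qed

definition T_product :: "'d \<times> 'h lin_dual \<Rightarrow> 'd \<times> 'h lin_dual \<Rightarrow> 'd \<times> 'h lin_dual" where
  "T_product = (\<lambda>(x1, \<alpha>1) (x2, \<alpha>2).
    ((1/2) *\<^sub>R (dbr x1 x2 + \<pi> (sharp hB \<alpha>1) x2 - \<pi> (sharp hB \<alpha>2) x1),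
     (1/2) *\<^sub>R beta dB \<pi> x1 x2 + flat hB (hbr (sharp hB \<alpha>1) (sharp hB \<alpha>2))))"

text \<open>The two coadjoint terms of the bracket of \<open>\<gg>\<close> are equal, namely \<open>[h\<^sub>1, h\<^sub>2]\<^sup>*\<close>; this is why the factor
\<open>1/2\<close> is absent from the last term of the explicit formula.\<close>

lemma T_alg_eq: "T_alg hbr hB dbr dB \<pi> = T_product"
proof (intro ext)
  fix a b :: "'d \<times> 'h lin_dual"
  obtain x1 \<alpha>1 x2 \<alpha>2 where ab: "a = (x1, \<alpha>1)" "b = (x2, \<alpha>2)" by (cases a, cases b)
  define h1 h2 where "h1 = sharp hB \<alpha>1" and "h2 = sharp hB \<alpha>2"
  have \<alpha>: "\<alpha>1 = flat hB h1" "\<alpha>2 = flat hB h2" by (simp_all add: h1_def h2_def)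
  have "(1/2) *\<^sub>R (coad hbr h1 (flat hB h2) - coad hbr h2 (flat hB h1)) = flat hB (hbr h1 h2)"
    by (simp add: coad_flat[OF h_lie h_metric] hbr_antisym[of h2] flat_lin flip: scaleR_2)
  then have "(1/2) *\<^sub>R (beta dB \<pi> x1 x2 + coad hbr h1 (flat hB h2) - coad hbr h2 (flat hB h1))
      = (1/2) *\<^sub>R beta dB \<pi> x1 x2 + flat hB (hbr h1 h2)"
    by (simp add: algebra_simps)
  then show "T_alg hbr hB dbr dB \<pi> a b = T_product a b"
    by (simp add: T_alg_def T_product_def ab lam_def[of hB, THEN fun_cong, of "(_, _)", simplified]
        \<alpha> m_part_eq inv_lam)
qed

lemma T_alg_explicit:
  "T_alg hbr hB dbr dB \<pi> (x1, flat hB h1) (x2, flat hB h2) =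
    (1/2) *\<^sub>R (Gd_bracket dbr dB \<pi> (x1, 0) (x2, 0) + (\<pi> h1 x2 - \<pi> h2 x1, 0))
      + (0, flat hB (hbr h1 h2))"
  by (simp add: T_alg_eq T_product_def algebra_simps)

text \<open>The Levi-Civita product from the Koszul formula. In
\<open>2\<langle>\<gamma>(a, b), c\<rangle> = \<langle>[a, b], c\<rangle> - \<langle>[b, c], a\<rangle> + \<langle>[c, a], b\<rangle>\<close> the contributions of the bracket of \<open>\<dd>\<close> add
up to \<open>\<langle>[x\<^sub>1, x\<^sub>2], x\<^sub>3\<rangle>\<close> by invariance, and those of \<open>\<beta>\<close> give the terms with \<open>\<pi>\<close>.\<close>

definition lc_product :: "'d \<times> 'h lin_dual \<Rightarrow> 'd \<times> 'h lin_dual \<Rightarrow> 'd \<times> 'h lin_dual" where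
  "lc_product = (\<lambda>(x1, \<alpha>1) (x2, \<alpha>2).
    ((1/2) *\<^sub>R (dbr x1 x2 - \<pi> (sharp hB \<alpha>1) x2 - \<pi> (sharp hB \<alpha>2) x1),
     (1/2) *\<^sub>R beta dB \<pi> x1 x2))"

text \<open>The operator \<open>-\<rho>(h\<^sub>1)\<close>, where \<open>\<rho>\<close> is the sum of \<open>\<pi>\<close> and the adjoint representation of \<open>\<hh>\<close> carried
over to \<open>\<hh>\<^sup>*\<close>. It is the action of the isotropy subalgebra \<open>\<hh>\<close> on \<open>\<mm>\<close>, up to sign.\<close>

definition isotropy :: "'d \<times> 'h lin_dual \<Rightarrow> 'd \<times> 'h lin_dual \<Rightarrow> 'd \<times> 'h lin_dual" where
  "isotropy = (\<lambda>(x1, \<alpha>1) (x2, \<alpha>2).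
    (- \<pi> (sharp hB \<alpha>1) x2, - flat hB (hbr (sharp hB \<alpha>1) (sharp hB \<alpha>2))))"

lemma bilinear_T_product: "bilinear T_product"
  unfolding bilinear_def T_product_def
  by (intro conjI allI linearI; clarify?)
    (auto simp: split_paired_all lin sharp_lin flat_lin beta_lin algebra_simps)

lemma bilinear_lc_product: "bilinear lc_product"
  unfolding bilinear_def lc_product_def
  by (intro conjI allI linearI; clarify?)
    (auto simp: split_paired_all lin sharp_lin beta_lin algebra_simps)

lemma isotropy_eq: "isotropy a b = lc_product a b - T_product a b"
proof -
  have half: "(1/2) *\<^sub>R (x - y - z) - (1/2) *\<^sub>R (x + y - z) = - y" for x y z :: 'd
  proof -
    have "(1/2) *\<^sub>R (x - y - z) - (1/2) *\<^sub>R (x + y - z) = (1/2) *\<^sub>R (- y - y)"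
      by (simp add: algebra_simps)
    also have "- y - y = 2 *\<^sub>R (- y)" by (simp add: scaleR_2)
    finally show ?thesis by simp
  qed
  show ?thesis
    by (cases a, cases b) (simp add: isotropy_def lc_product_def T_product_def half)
qed

lemma lc_product_torsion: "lc_product a b - lc_product b a = Gd_bracket dbr dB \<pi> a b"
proof -
  obtain x1 \<alpha>1 x2 \<alpha>2 where ab: "a = (x1, \<alpha>1)" "b = (x2, \<alpha>2)" by (cases a, cases b)
  have half: "(1/2) *\<^sub>R x + (1/2) *\<^sub>R x = x" for x :: "'z::real_vector"
    by (simp flip: scaleR_left_distrib)
  show ?thesis
    using half[of "dbr x1 x2"] half[of "beta dB \<pi> x1 x2"]
    by (simp add: ab lc_product_def dbr_antisym[of x2] beta_antisym[of x2] scaleR_diff_right)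
qed

lemma lc_product_metric:
  "Gd_metric hB dB (lc_product a b) c + Gd_metric hB dB b (lc_product a c) = 0"
proof -
  obtain x1 \<alpha>1 x2 \<alpha>2 x3 \<alpha>3 where abc: "a = (x1, \<alpha>1)" "b = (x2, \<alpha>2)" "c = (x3, \<alpha>3)"
    by (cases a, cases b, cases c)
  have sym: "Gd_metric hB dB b (lc_product a c) = Gd_metric hB dB (lc_product a c) b"
    by (cases b, cases "lc_product a c") (simp add: hB_sym dB_sym)
  show ?thesis
    unfolding sym unfolding abc lc_product_def
    using dB_inv[of x1 x2 x3] \<pi>_skew[of "sharp hB \<alpha>1" x2 x3] dB_sym[of x2]
    by (simp add: Gd_metric_eq dual_app_simps dual_app_beta lin algebra_simps del: Gd_metric.simps)
qed

lemma T_product_skew: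
  "Gd_metric hB dB (T_product a b) c + Gd_metric hB dB b (T_product a c) = 0"
proof -
  obtain x1 \<alpha>1 x2 \<alpha>2 x3 \<alpha>3 where abc: "a = (x1, \<alpha>1)" "b = (x2, \<alpha>2)" "c = (x3, \<alpha>3)"
    by (cases a, cases b, cases c)
  have sym: "Gd_metric hB dB b (T_product a c) = Gd_metric hB dB (T_product a c) b"
    by (cases b, cases "T_product a c") (simp add: hB_sym dB_sym)
  show ?thesis
    unfolding sym unfolding abc T_product_def
    using dB_inv[of x1 x2 x3] \<pi>_skew[of "sharp hB \<alpha>1" x2 x3] dB_sym[of x2]
      hB_inv[of "sharp hB \<alpha>1" "sharp hB \<alpha>2" "sharp hB \<alpha>3"] hB_sym[of "sharp hB \<alpha>2"]
    by (simp add: Gd_metric_eq dual_app_simps dual_app_beta dual_app_flat[OF h_lie h_metric] lin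
        algebra_simps del: Gd_metric.simps)
qed

lemma T_product_alt: "T_product a a = 0"
proof -
  have "dbr x x = 0" "hbr h h = 0" "beta dB \<pi> x x = 0" for x h
    using h_lie d_lie dB_sym \<pi>_skew[of _ x x]
    by (auto simp: lie_algebra_def dual_app_beta dual_app_simps intro!: lin_dual_eqI)
  then show ?thesis by (cases a) (simp add: T_product_def flat_lin zero_prod_def)
qed

text \<open>On the \<open>\<dd>\<close>-component this is the derivation property of \<open>\<pi>(h)\<close> together with the homomorphism
property of \<open>\<pi>\<close>; on the \<open>\<hh>\<^sup>*\<close>-component it is the equivariance of \<open>\<beta>\<close>.\<close>

lemma isotropy_lc_product:
  "isotropy a (lc_product b c) = lc_product (isotropy a b) c + lc_product b (isotropy a c)"
  by (cases a, cases b, cases c)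
    (simp add: isotropy_def lc_product_def lin sharp_lin flat_lin beta_lin beta_equivariant \<pi>_der \<pi>_hom
      algebra_simps)

text \<open>As for \<open>lc_product\<close>, with the Jacobi identity of \<open>\<hh>\<close> for the additional term \<open>[h\<^sub>1, h\<^sub>2]\<^sup>*\<close>.\<close>

lemma isotropy_T_product:
  "isotropy a (T_product b c) = T_product (isotropy a b) c + T_product b (isotropy a c)"
proof -
  obtain x1 \<alpha>1 x2 \<alpha>2 x3 \<alpha>3 where abc: "a = (x1, \<alpha>1)" "b = (x2, \<alpha>2)" "c = (x3, \<alpha>3)"
    by (cases a, cases b, cases c)
  show ?thesis
    unfolding abc
    by (simp add: isotropy_def T_product_def lin sharp_lin flat_lin beta_lin beta_equivariant \<pi>_der \<pi>_hom
        hbr_leibniz[of "sharp hB \<alpha>1" "sharp hB \<alpha>2" "sharp hB \<alpha>3"] algebra_simps)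
qed

lemma Gd_metric_nondegenerate:
  assumes "\<And>b. Gd_metric hB dB a b = 0"
  shows "a = 0"
proof (cases a)
  case (Pair x \<alpha>)
  have "dB x y = 0" for y
    using assms[of "(y, 0)"] Pair by (simp add: sharp_lin lin)
  then have "x = 0" using d_metric by (simp add: ad_invariant_metric_def)
  have "dual_app \<alpha> h = 0" for h
    using assms[of "(0, flat hB h)"] Pair
    by (simp add: Gd_metric_eq lin del: Gd_metric.simps)
  then have "\<alpha> = 0" by (intro lin_dual_eqI) (simp add: dual_app_simps)
  with \<open>x = 0\<close> Pair show ?thesis by (simp add: zero_prod_def)
qed

end

theorem theorem3p4:
  fixes hbr :: "'h::real_vector \<Rightarrow> 'h \<Rightarrow> 'h" and hB :: "'h \<Rightarrow> 'h \<Rightarrow> real"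
    and dbr :: "'d::real_vector \<Rightarrow> 'd \<Rightarrow> 'd" and dB :: "'d \<Rightarrow> 'd \<Rightarrow> real"
    and \<pi> :: "'h \<Rightarrow> 'd \<Rightarrow> 'd"
    and A :: "('g::{t2_space, second_countable_topology}, 'e::real_inner) chart set"
    and mul :: "'g \<Rightarrow> 'g \<Rightarrow> 'g" and e :: 'g and iv :: "'g \<Rightarrow> 'g"
    and \<iota> :: "'d \<times> 'h lin_dual \<Rightarrow> 'g vfield"
  assumes "lie_algebra hbr" and "ad_invariant_metric hbr hB"
    and "lie_algebra dbr" and "ad_invariant_metric dbr dB"
    and "lie_hom_Dera hbr dbr dB \<pi>"
    and "lie_group A mul e iv" and "simply_connected (UNIV :: 'g set)"
    and "is_lie_algebra_of A mul e (Gd_bracket dbr dB \<pi>) \<iota>"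
  shows "(\<forall>x1 x2 h1 h2.
            T_alg hbr hB dbr dB \<pi> (x1, flat hB h1) (x2, flat hB h2) =
              (1/2) *\<^sub>R (Gd_bracket dbr dB \<pi> (x1, 0) (x2, 0) + (\<pi> h1 x2 - \<pi> h2 x1, 0))
                + (0, flat hB (hbr h1 h2)))
         \<and> naturally_reductive_structure A
             (left_metric \<iota> (Gd_metric hB dB))
             (left_tensor \<iota> (T_alg hbr hB dbr dB \<pi>))"
proof -
  interpret double_extension_data hbr hB dbr dB \<pi>
    using assms(1-5) by unfold_locales
  have "fin_dim TYPE('d)" using assms(3) by (simp add: lie_algebra_def)
  then interpret lie_frame A \<iota> "Gd_bracket dbr dB \<pi>"
    by (intro lie_group_frame[OF assms(6) fin_dim_prod_dual[OF assms(1,2)] bilinear_Gd_bracket assms(8)])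
  have "naturally_reductive_structure A (left_metric \<iota> (Gd_metric hB dB)) (left_tensor \<iota> T_product)"
  proof (rule naturally_reductive_left_tensor[where \<gamma> = lc_product and D = isotropy])
    show "connected (UNIV :: 'g set)" "simply_connected (UNIV :: 'g set)"
      using assms(7) connected_if_simply_connected by auto
    show "Gd_metric hB dB a b = Gd_metric hB dB b a" for a b
      by (cases a, cases b) (simp add: hB_sym dB_sym)
  qed (fact bilinear_Gd_metric Gd_metric_nondegenerate bilinear_lc_product lc_product_torsion
      lc_product_metric bilinear_T_product T_product_skew T_product_alt isotropy_eq
      isotropy_lc_product isotropy_T_product)+
  then show ?thesis
    using T_alg_explicit by (simp add: T_alg_eq)
qed

end
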